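(* Let $\{\mathcal{A}_n(x)\}_{n\ge0}$ be the scaled Atkin polynomials and let $\tilde U_n^{(\alpha,\beta)}(x;c)$, $\tilde Y_n^{(\alpha,\beta)}(x;c)$ be the functions defined in the context. Then for every integer $n\ge0$ and every $x\in\mathbb{C}\setminus[1,\infty)$, $$\mathcal{A}_{n+1}(x)=C(x)\,\tilde U_n^{(\frac12,-\frac23)}\left(x;\tfrac{7}{12}\right)+D(x)\,\tilde Y_n^{(\frac12,-\frac23)}\left(x;\tfrac{7}{12}\right),$$ where $$C(x)=-\frac{1}{60}\left(24\,F\left(-\tfrac{5}{12},-\tfrac{5}{12};-\tfrac13;x\right)+F\left(-\tfrac{5}{12},-\tfrac{5}{12};\tfrac23;x\right)\right),$$ $$D(x)=\frac{91}{384}\,x\left(4\,F\left(-\tfrac{1}{12},-\tfrac{1}{12};\tfrac13;x\right)-5\,F\left(\tfrac{11}{12},-\tfrac{1}{12};\tfrac43;x\right)\right).$$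
   Context: Scaled Atkin polynomials: $\mathcal{A}_0(x)=1$, $\mathcal{A}_1(x)=x-\frac{5}{12}$, $\mathcal{A}_2(x)=x^2-\frac{205}{216}x+\frac{935}{10368}$, and for $n>1$ $$\mathcal{A}_{n+1}(x)=\left[x-\frac{2(n^2-29/144)}{4n^2-1}\right]\mathcal{A}_n(x)-\frac{(n-\frac{13}{12})(n-\frac{7}{12})(n-\frac{5}{12})(n+\frac1{12})}{2n(2n-1)^2(2n-2)}\mathcal{A}_{n-1}(x).$$ (They are related to the Atkin polynomials $A_n$ by $A_n(1728y)=1728^n\mathcal{A}_n(y)$.) $F(a,b;d;x)$ is the Gauss hypergeometric function ${}_2F_1(a,b;d;x)$ (the power series for $|x|<1$, continued analytically to $\mathbb{C}\setminus[1,\infty)$), and $(a)_m=a(a+1)\cdots(a+m-1)$, $(a)_0=1$. Define $$U_n^{(\alpha,\beta)}(x;c)=(-1)^n\frac{(\beta+c+1)_n}{(c+1)_n}F(-n-c,\ n+\alpha+\beta+c+1;\ 1+\beta;\ x),$$ $$Y_n^{(\alpha,\beta)}(x;c)=(-1)^n\frac{(\alpha+c+1)_n}{(\alpha+\beta+c+1)_n}F(-n-\beta-c,\ n+\alpha+c+1;\ 1-\beta;\ x),$$ $$\tilde U_n^{(\alpha,\beta)}(x;c)=\frac{(c+1)_n(\alpha+\beta+c+1)_n}{(\alpha+\beta+2c+1)_{2n}}U_n^{(\alpha,\beta)}(x;c),\qquad \tilde Y_n^{(\alpha,\beta)}(x;c)=\frac{(c+1)_n(\alpha+\beta+c+1)_n}{(\alpha+\beta+2c+1)_{2n}}Y_n^{(\alpha,\beta)}(x;c).$$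 *)

theory Defs
  imports "HOL-Complex_Analysis.Complex_Analysis" "HOL-Computational_Algebra.Polynomial"
begin

definition cut_plane :: "complex set" where
  "cut_plane = UNIV - complex_of_real ` {1..}"

definition hyp2F1_series :: "complex \<Rightarrow> complex \<Rightarrow> complex \<Rightarrow> complex \<Rightarrow> complex" where
  "hyp2F1_series a b d z =
     (\<Sum>k. pochhammer a k * pochhammer b k / (pochhammer d k * fact k) * z ^ k)"

(* The cut plane is open, connected and contains the unit disc, so the continuation selected
   by SOME is determined on the cut plane by the identity theorem. It is the principal branch
   whenever d is not a nonpositive integer; values on [1, \<infinity>) are unspecified. *)
definition hyp2F1 :: "complex \<Rightarrow> complex \<Rightarrow> complex \<Rightarrow> complex \<Rightarrow> complex" where
  "hyp2F1 a b d =
     (SOME f. f holomorphic_on cut_plane \<and> (\<forall>z\<in>ball 0 1. f z = hyp2F1_series a b d z))"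

(* The last equation is the three-term recurrence at index n = Suc (Suc m) > 1. *)
fun atkin :: "nat \<Rightarrow> complex poly" where
  "atkin 0 = 1"
| "atkin (Suc 0) = [:- 5/12, 1:]"
| "atkin (Suc (Suc 0)) = [:935/10368, - 205/216, 1:]"
| "atkin (Suc (Suc (Suc m))) =
     (let n = of_nat (Suc (Suc m)) in
        [:- (2 * (n\<^sup>2 - 29/144) / (4 * n\<^sup>2 - 1)), 1:] * atkin (Suc (Suc m))
        - smult ((n - 13/12) * (n - 7/12) * (n - 5/12) * (n + 1/12)
                   / (2 * n * (2 * n - 1)\<^sup>2 * (2 * n - 2)))
            (atkin (Suc m)))"

definition U :: "complex \<Rightarrow> complex \<Rightarrow> nat \<Rightarrow> complex \<Rightarrow> complex \<Rightarrow> complex" where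
  "U \<alpha> \<beta> n x c =
     (- 1) ^ n * (pochhammer (\<beta> + c + 1) n / pochhammer (c + 1) n)
       * hyp2F1 (- of_nat n - c) (of_nat n + \<alpha> + \<beta> + c + 1) (1 + \<beta>) x"

definition Y :: "complex \<Rightarrow> complex \<Rightarrow> nat \<Rightarrow> complex \<Rightarrow> complex \<Rightarrow> complex" where
  "Y \<alpha> \<beta> n x c =
     (- 1) ^ n * (pochhammer (\<alpha> + c + 1) n / pochhammer (\<alpha> + \<beta> + c + 1) n)
       * hyp2F1 (- of_nat n - \<beta> - c) (of_nat n + \<alpha> + c + 1) (1 - \<beta>) x"

definition U_tilde :: "complex \<Rightarrow> complex \<Rightarrow> nat \<Rightarrow> complex \<Rightarrow> complex \<Rightarrow> complex" where
  "U_tilde \<alpha> \<beta> n x c =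
     pochhammer (c + 1) n * pochhammer (\<alpha> + \<beta> + c + 1) n
       / pochhammer (\<alpha> + \<beta> + 2 * c + 1) (2 * n) * U \<alpha> \<beta> n x c"

definition Y_tilde :: "complex \<Rightarrow> complex \<Rightarrow> nat \<Rightarrow> complex \<Rightarrow> complex \<Rightarrow> complex" where
  "Y_tilde \<alpha> \<beta> n x c =
     pochhammer (c + 1) n * pochhammer (\<alpha> + \<beta> + c + 1) n
       / pochhammer (\<alpha> + \<beta> + 2 * c + 1) (2 * n) * Y \<alpha> \<beta> n x c"

definition C_coeff :: "complex \<Rightarrow> complex" where
  "C_coeff x =
     - (1/60) * (24 * hyp2F1 (- 5/12) (- 5/12) (- 1/3) x + hyp2F1 (- 5/12) (- 5/12) (2/3) x)"

definition D_coeff :: "complex \<Rightarrow> complex" where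
  "D_coeff x =
     91/384 * x * (4 * hyp2F1 (- 1/12) (- 1/12) (1/3) x - 5 * hyp2F1 (11/12) (- 1/12) (4/3) x)"

end

theory Submission
  imports Defs
begin

text \<open>
  Both sides are holomorphic on the slit plane, so it suffices to compare Taylor series at 0. The
  analytic continuation of a hypergeometric series is Euler's integral when the parameters are large,
  and the other parameters are reached by differentiating and by taking primitives on the starlike
  slit plane.

  The combinations on the right-hand side satisfy the three-term recurrence of the Atkin polynomials
  because this recurrence is the contiguous relation between F(a-1,b+1;c), F(a,b;c) and F(a+1,b-1;c).
  Both functions F(a-1,b+1;c) and F(a+1,b-1;c) are combinations of F and its derivative, and
  eliminating the derivative gives the relation. For the initial values put
  f = F(5/12,5/12;1/3) and g = F(13/12,13/12;5/3). By Euler's transformation C(x) is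
  (1-x)^(1/2) times a combination of g and g', and D(x) is (1-x)^(1/2) times a combination of f and
  f'. In the first two combinations with the U and Y functions, the products of f, f', g, g' collapse
  to a polynomial times the Wronskian of f and x^(2/3) g, which by Abel's identity is a multiple of
  (1-x)^(-3/2).
\<close>

section \<open>Analytic continuation of the hypergeometric series\<close>

definition hyp2F1_fps :: "complex \<Rightarrow> complex \<Rightarrow> complex \<Rightarrow> complex fps" where
  "hyp2F1_fps a b c = Abs_fps (\<lambda>k. pochhammer a k * pochhammer b k / (pochhammer c k * fact k))"

lemma hyp2F1_fps_nth:
  "fps_nth (hyp2F1_fps a b c) k = pochhammer a k * pochhammer b k / (pochhammer c k * fact k)"
  by (simp add: hyp2F1_fps_def)

lemma not_nonpos_Int_add_of_nat:
  "c + of_nat k \<noteq> 0" if "c \<notin> \<int>\<^sub>\<le>\<^sub>0" for c :: complex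
  using that by (metis add.commute add_cancel_right_right add_diff_cancel_left' diff_0
      minus_of_nat_in_nonpos_Ints)

section \<open>Geometry of the slit plane\<close>

lemma open_cut_plane: "open cut_plane"
proof -
  have "closed (complex_of_real ` {1..})"
    by (rule closed_injective_linear_image) (auto intro: linearI injI simp: scaleR_conv_of_real)
  thus ?thesis by (simp add: cut_plane_def Compl_eq_Diff_UNIV [symmetric] open_Compl)
qed

lemma starlike_cut_plane: "starlike cut_plane"
  using starlike_slotted_complex_plane_right[of 1]
  by (simp add: cut_plane_def Compl_eq_Diff_UNIV)

lemma connected_cut_plane: "connected cut_plane"
  by (rule starlike_imp_connected[OF starlike_cut_plane])

lemma ball_subset_cut_plane: "ball 0 1 \<subseteq> cut_plane"
  by (auto simp: cut_plane_def)

lemma zero_in_cut_plane: "0 \<in> cut_plane"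
  using ball_subset_cut_plane by auto

text \<open>If 1 - z t were some r <= 0, then t > 0 and z = (1 - r)/t >= 1 would lie on the slit.
  Hence the power in Euler's integral never meets its branch cut.\<close>

lemma one_minus_mult_not_nonpos_Real:
  assumes "z \<in> cut_plane" "t \<in> {0..1}"
  shows   "1 - z * of_real t \<notin> \<real>\<^sub>\<le>\<^sub>0"
proof
  assume "1 - z * of_real t \<in> \<real>\<^sub>\<le>\<^sub>0"
  then obtain r where r: "r \<le> 0" "1 - z * of_real t = of_real r"
    by (auto elim: nonpos_Reals_cases)
  have "t \<noteq> 0"
  proof
    assume "t = 0"
    with r(2) have "complex_of_real r = of_real 1" by simp
    with r(1) show False by (simp only: of_real_eq_iff)
  qed
  with assms(2) have "t > 0" by simp
  have "z = of_real ((1 - r) / t)"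
    using r(2) \<open>t > 0\<close> by (simp add: field_simps)
  moreover have "(1 - r) / t \<ge> 1"
    using r(1) \<open>t > 0\<close> assms(2) by (simp add: field_simps)
  ultimately show False
    using assms(1) unfolding cut_plane_def by blast
qed

section \<open>Euler's integral and its power series\<close>

definition euler_weight :: "real \<Rightarrow> real \<Rightarrow> real \<Rightarrow> real" where
  "euler_weight b c t = t powr (b - 1) * (1 - t) powr (c - b - 1)"

text \<open>Left unnormalised: for 1 < b and 1 < c - b it is B(b, c - b) times the hypergeometric
  series on the unit disc.\<close>

definition euler_integral :: "complex \<Rightarrow> real \<Rightarrow> real \<Rightarrow> complex \<Rightarrow> complex" where
  "euler_integral a b c z =
     integral {0..1} (\<lambda>t. of_real (euler_weight b c t) * (1 - z * of_real t) powr (- a))"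

text \<open>The bounds on the exponents are strict because $0$ powr $0$ is $0$, which would make the
  integrand discontinuous at an end point.\<close>

lemma continuous_on_euler_weight [continuous_intros]:
  assumes "1 < b" "1 < c - b" "continuous_on A f" "f ` A \<subseteq> {0..1}"
  shows   "continuous_on A (\<lambda>x. euler_weight b c (f x))"
  unfolding euler_weight_def using assms
  by (intro continuous_intros continuous_on_powr') (auto simp: image_subset_iff)

lemma continuous_on_one_minus_mult_powr:
  assumes "continuous_on A f" "continuous_on A g" "f ` A \<subseteq> cut_plane" "g ` A \<subseteq> {0..1}"
  shows   "continuous_on A (\<lambda>x. (1 - f x * complex_of_real (g x)) powr s)"
proof (rule continuous_on_powr_complex)
  show "A \<subseteq> {x. 0 \<le> Re (1 - f x * complex_of_real (g x)) \<or> Im (1 - f x * complex_of_real (g x)) \<noteq> 0}"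
    using assms one_minus_mult_not_nonpos_Real by (fastforce simp: complex_nonpos_Reals_iff image_subset_iff)
  \<comment> \<open>Only a vanishing base calls for this condition, and the base avoids all
    nonpositive reals.\<close>
  show "0 < Re s" if "x \<in> A" "1 - f x * complex_of_real (g x) = 0" for x
    using that assms one_minus_mult_not_nonpos_Real[of "f x" "g x"] by (auto simp: image_subset_iff)
qed (use assms in \<open>auto intro!: continuous_intros\<close>)

text \<open>Differentiation under the integral sign on a small disc inside the slit plane; the
  derivative of the integrand in z is jointly continuous there.\<close>

lemma holomorphic_euler_integral:
  assumes "1 < b" "1 < c - b"
  shows   "euler_integral a b c holomorphic_on cut_plane"
proof -
  have "euler_integral a b c analytic_on cut_plane"
    unfolding analytic_on_def
  proof
    fix z assume "z \<in> cut_plane"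
    then obtain e where e: "e > 0" "ball z e \<subseteq> cut_plane"
      using open_cut_plane by (auto simp: open_contains_ball)
    have "(\<lambda>x. integral (cbox 0 1) (\<lambda>t. of_real (euler_weight b c t) * (1 - x * of_real t) powr (- a)))
            holomorphic_on ball z e"
    proof (rule leibniz_rule_holomorphic)
      fix x t assume x: "x \<in> ball z e" and t: "t \<in> cbox (0::real) 1"
      have "1 - x * of_real t \<notin> \<real>\<^sub>\<le>\<^sub>0"
        using x t e one_minus_mult_not_nonpos_Real by auto
      thus "((\<lambda>x. of_real (euler_weight b c t) * (1 - x * of_real t) powr (- a))
              has_field_derivative
              of_real (euler_weight b c t) * (a * of_real t * (1 - x * of_real t) powr (- a - 1)))
            (at x within ball z e)"
        by (auto intro!: derivative_eq_intros)
    next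
      fix x assume "x \<in> ball z e"
      thus "(\<lambda>t. of_real (euler_weight b c t) * (1 - x * of_real t) powr (- a)) integrable_on cbox 0 1"
        using e assms
        by (intro integrable_continuous continuous_intros continuous_on_one_minus_mult_powr) auto
    next
      show "continuous_on (ball z e \<times> cbox 0 1) (\<lambda>(x, t). of_real (euler_weight b c t) *
               (a * of_real t * (1 - x * of_real t) powr (- a - 1)))"
        using e assms unfolding case_prod_unfold
        by (intro continuous_intros continuous_on_one_minus_mult_powr) auto
    qed auto
    with e show "\<exists>e>0. euler_integral a b c holomorphic_on ball z e"
      by (auto simp: euler_integral_def [abs_def])
  qed
  thus ?thesis by (rule analytic_imp_holomorphic)
qed

text \<open>The factor t^k shifts b to b + k in the Beta integral, and the quotient of the Gamma
  values is a quotient of Pochhammer symbols.\<close>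

lemma has_integral_euler_weight_power:
  assumes "0 < b" "b < c"
  shows "((\<lambda>t. euler_weight b c t * t ^ k) has_integral
            Beta b (c - b) * (pochhammer b k / pochhammer c k)) {0..1}"
proof -
  have "((\<lambda>t. t powr (b + real k - 1) * (1 - t) powr (c - b - 1)) has_integral
           Beta (b + real k) (c - b)) {0..1}"
    using assms by (intro has_integral_Beta_real) auto
  moreover have "Beta (b + real k) (c - b) = Beta b (c - b) * (pochhammer b k / pochhammer c k)"
  proof -
    have "b \<notin> \<int>\<^sub>\<le>\<^sub>0" "c \<notin> \<int>\<^sub>\<le>\<^sub>0" using assms by (auto elim!: nonpos_Ints_cases)
    moreover have "Gamma b > 0" "Gamma c > 0" using assms by auto
    ultimately show ?thesis
      by (simp add: Beta_def pochhammer_Gamma field_simps)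
  qed
  moreover have "t powr (b + real k - 1) * (1 - t) powr (c - b - 1) = euler_weight b c t * t ^ k"
    if "t \<in> {0..1}" for t :: real
  \<comment> \<open>At t = 0 both sides vanish because \<open>0 powr s\<close> is 0 for every s,
    even when k = 0.\<close>
  proof (cases "t = 0")
    case False
    hence "t powr (b + real k - 1) = t powr (b - 1) * t ^ k"
      using that by (simp add: powr_realpow [symmetric] powr_add [symmetric] algebra_simps)
    thus ?thesis by (simp add: euler_weight_def)
  qed (auto simp: euler_weight_def)
  ultimately show ?thesis
    by (subst has_integral_cong [of _ _ "\<lambda>t. t powr (b + real k - 1) * (1 - t) powr (c - b - 1)"]) auto
qed

text \<open>Expand (1 - z t)^(-a) by the binomial theorem. For fixed z in the unit disc the
  Weierstrass test bounds the terms uniformly in t, so the series may be integrated termwise; the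
  moments of the weight supply the coefficients.\<close>

lemma euler_integral_sums:
  assumes "1 < b" "1 < c - b" "norm z < 1"
  shows   "(\<lambda>k. of_real (Beta b (c - b)) * fps_nth (hyp2F1_fps a (of_real b) (of_real c)) k * z ^ k)
             sums euler_integral a b c z"
proof -
  define w where "w = euler_weight b c"
  define f where "f = (\<lambda>k t. of_real (w t) * (((- a) gchoose k) * (- (z * of_real t)) ^ k))"
  define g where "g = (\<lambda>t. of_real (w t) * (1 - z * of_real t) powr (- a))"
  have cont_w: "continuous_on {0..1} w"
    unfolding w_def using assms by (intro continuous_intros) auto
  have "bounded (w ` {0..1})"
    using cont_w by (intro compact_imp_bounded compact_continuous_image) auto
  then obtain B where B: "\<And>t. t \<in> {0..1} \<Longrightarrow> \<bar>w t\<bar> \<le> B"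
    unfolding bounded_iff by (metis imageI real_norm_def)
  have cont_f: "continuous_on {0..1} (f k)" for k
    unfolding f_def using cont_w by (intro continuous_intros)
  have f_sums: "(\<lambda>k. f k t) sums g t" if "t \<in> {0..1}" for t
  proof -
    have "norm (z * of_real t) \<le> norm z * 1"
      using that unfolding norm_mult by (intro mult_left_mono) auto
    hence "norm (- (z * of_real t)) < 1" using assms by simp
    from sums_mult[OF gen_binomial_complex[OF this, of "- a"], of "of_real (w t)"]
    show ?thesis by (simp add: f_def g_def)
  qed
  have "uniform_limit {0..1} (\<lambda>n t. \<Sum>k<n. f k t) (\<lambda>t. \<Sum>k. f k t) sequentially"
  proof (rule Weierstrass_m_test)
    show "norm (f k t) \<le> B * (norm ((- a) gchoose k) * norm z ^ k)" if "t \<in> {0..1}" for k t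
    proof -
      have "t ^ k \<le> 1" using that by (intro power_le_one) auto
      hence "norm z ^ k * t ^ k \<le> norm z ^ k"
        by (intro mult_left_le) auto
      hence "norm (- (z * of_real t)) ^ k \<le> norm z ^ k"
        using that by (simp add: norm_mult power_mult_distrib)
      thus ?thesis
        unfolding f_def norm_mult norm_power
        using B[OF that] by (intro mult_mono) (auto intro!: mult_nonneg_nonneg)
    qed
    have "summable (\<lambda>k. norm (((- a) gchoose k) * z ^ k))"
      using assms by (intro abs_summable_in_conv_radius) (auto simp: conv_radius_gchoose)
    thus "summable (\<lambda>k. B * (norm ((- a) gchoose k) * norm z ^ k))"
      by (intro summable_mult) (simp add: norm_mult norm_power)
  qed
  also have "?this \<longleftrightarrow> uniform_limit {0..1} (\<lambda>n t. \<Sum>k<n. f k t) g sequentially"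
    using f_sums by (intro uniform_limit_cong) (auto simp: sums_iff)
  finally obtain I J where IJ:
    "\<And>n. ((\<lambda>t. \<Sum>k<n. f k t) has_integral I n) {0..1}" "(g has_integral J) {0..1}" "I \<longlonglongrightarrow> J"
    by (rule uniform_limit_integral) (use cont_f in \<open>auto intro!: continuous_intros\<close>)
  have J: "J = euler_integral a b c z"
    using IJ(2) by (simp add: euler_integral_def g_def w_def integral_unique)
  define h where "h = (\<lambda>k. of_real (Beta b (c - b)) * fps_nth (hyp2F1_fps a (of_real b) (of_real c)) k * z ^ k)"
  have f_int: "(f k has_integral h k) {0..1}" for k
  proof -
    have "((\<lambda>t. complex_of_real (w t * t ^ k)) has_integral
             of_real (Beta b (c - b) * (pochhammer b k / pochhammer c k))) {0..1}"
      unfolding w_def using assms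
      by (intro has_integral_of_real has_integral_euler_weight_power) auto
    from has_integral_mult_right[OF this, of "((- a) gchoose k) * (-1) ^ k * z ^ k"]
    have "((\<lambda>t. ((- a) gchoose k) * (-1) ^ k * z ^ k * complex_of_real (w t * t ^ k)) has_integral
             ((- a) gchoose k) * (-1) ^ k * z ^ k * 
             of_real (Beta b (c - b) * (pochhammer b k / pochhammer c k))) {0..1}" .
    also have "(\<lambda>t. ((- a) gchoose k) * (-1) ^ k * z ^ k * complex_of_real (w t * t ^ k)) = f k"
      by (auto simp: f_def power_mult_distrib power_minus[of "z * _"] mult_ac)
    also have "((- a) gchoose k) * (-1) ^ k = pochhammer a k / fact k"
      by (simp add: gbinomial_pochhammer)
    also have "pochhammer a k / fact k * z ^ k * of_real (Beta b (c - b) * (pochhammer b k / pochhammer c k)) = h k"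
      by (simp add: h_def hyp2F1_fps_nth pochhammer_of_real mult_ac)
    finally show ?thesis .
  qed
  have "I n = (\<Sum>k<n. h k)" for n
    using has_integral_unique[OF IJ(1)[of n] has_integral_sum[OF _ f_int]] by simp
  hence "I = (\<lambda>n. \<Sum>k<n. h k)" by auto
  with IJ(3) J show ?thesis
    by (simp add: sums_def h_def)
qed

section \<open>Continuation to all admissible real parameters b and c\<close>

lemma has_fps_expansion_sumsI:
  fixes f :: "complex \<Rightarrow> complex"
  assumes "r > 0" "\<And>z. norm z < r \<Longrightarrow> (\<lambda>k. fps_nth F k * z ^ k) sums f z"
  shows   "f has_fps_expansion F"
  unfolding has_fps_expansion_def
proof
  have "ereal (norm (of_real (r / 2) :: complex)) \<le> fps_conv_radius F"
    unfolding fps_conv_radius_def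
    by (rule conv_radius_geI, rule sums_summable, rule assms(2)) (use assms(1) in auto)
  thus "fps_conv_radius F > 0"
    by (rule less_le_trans[rotated]) (use assms(1) in auto)
  have "eventually (\<lambda>z. z \<in> ball 0 r) (nhds 0)"
    using assms(1) by (intro eventually_nhds_in_open) auto
  thus "eventually (\<lambda>z. eval_fps F z = f z) (nhds 0)"
    by eventually_elim (use assms(2) in \<open>auto simp: eval_fps_def sums_iff\<close>)
qed

text \<open>A property of the series and not of \<open>hyp2F1\<close>: the choice made by SOME there
  says nothing until some continuation is known to exist.\<close>

definition continuable :: "complex fps \<Rightarrow> bool" where
  "continuable F \<longleftrightarrow> (\<exists>f. f holomorphic_on cut_plane \<and> f has_fps_expansion F)"

lemma continuable_cmult:
  assumes "continuable F"
  shows   "continuable (fps_const a * F)"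
proof -
  obtain f where "f holomorphic_on cut_plane" "f has_fps_expansion F"
    using assms by (auto simp: continuable_def)
  hence "(\<lambda>z. a * f z) holomorphic_on cut_plane" "(\<lambda>z. a * f z) has_fps_expansion fps_const a * F"
    by (auto intro!: holomorphic_intros fps_expansion_intros)
  thus ?thesis unfolding continuable_def by blast
qed

lemma continuable_hyp2F1_fps_euler:
  assumes "1 < b" "1 < c - b"
  shows   "continuable (hyp2F1_fps a (of_real b) (of_real c))"
proof -
  define B where "B = complex_of_real (Beta b (c - b))"
  have "Gamma b > 0" "Gamma c > 0" "Gamma (c - b) > 0" using assms by auto
  hence "B \<noteq> 0" by (simp add: B_def Beta_def)
  have "euler_integral a b c has_fps_expansion fps_const B * hyp2F1_fps a (of_real b) (of_real c)"
    using euler_integral_sums[OF assms]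
    by (intro has_fps_expansion_sumsI[of 1]) (auto simp: B_def)
  hence "continuable (fps_const B * hyp2F1_fps a (of_real b) (of_real c))"
    using holomorphic_euler_integral[OF assms] unfolding continuable_def by blast
  from continuable_cmult[OF this, of "inverse B"] show ?thesis
    using \<open>B \<noteq> 0\<close> by (simp only: mult.assoc [symmetric] fps_const_mult) simp
qed

text \<open>The operator x d/dx multiplies the k-th coefficient by k, and (c + k)/c is the ratio of
  the coefficients for c and c + 1. So the continuation is f + z f'/c.\<close>

lemma continuable_hyp2F1_fps_lower_c:
  assumes "continuable (hyp2F1_fps a b (c + 1))" "c \<notin> \<int>\<^sub>\<le>\<^sub>0"
  shows   "continuable (hyp2F1_fps a b c)"
proof -
  define F where "F = hyp2F1_fps a b (c + 1)"
  have "c \<noteq> 0" using assms(2) by auto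
  have c: "c + of_nat k \<noteq> 0" for k by (rule not_nonpos_Int_add_of_nat) fact
  obtain f where f: "f holomorphic_on cut_plane" "f has_fps_expansion F"
    using assms(1) by (auto simp: continuable_def F_def)
  have "(\<lambda>z. f z + inverse c * (z * deriv f z)) has_fps_expansion
           F + fps_const (inverse c) * (fps_X * fps_deriv F)"
    by (intro fps_expansion_intros f)
  also have "F + fps_const (inverse c) * (fps_X * fps_deriv F) = hyp2F1_fps a b c"
  proof (rule fps_ext)
    fix k
    have "c * pochhammer (c + 1) k = (c + of_nat k) * pochhammer c k"
      using pochhammer_rec[of c k] pochhammer_rec'[of c k] by simp
    hence *: "pochhammer (c + 1) k = (c + of_nat k) * pochhammer c k / c"
      using \<open>c \<noteq> 0\<close> by (simp add: field_simps)
    have "fps_nth (F + fps_const (inverse c) * (fps_X * fps_deriv F)) k =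
            fps_nth F k * ((c + of_nat k) / c)"
      using \<open>c \<noteq> 0\<close> by (cases k) (auto simp: field_simps)
    also have "\<dots> = fps_nth (hyp2F1_fps a b c) k"
      using \<open>c \<noteq> 0\<close> c[of k] by (simp add: F_def hyp2F1_fps_nth *)
    finally show "fps_nth (F + fps_const (inverse c) * (fps_X * fps_deriv F)) k = \<dots>" .
  qed
  finally show ?thesis
    using f(1) open_cut_plane unfolding continuable_def
    by (intro exI[of _ "\<lambda>z. f z + inverse c * (z * deriv f z)"]) (auto intro!: holomorphic_intros)
qed

lemma fps_deriv_hyp2F1_fps:
  "fps_deriv (hyp2F1_fps a b c) = fps_const (a * b / c) * hyp2F1_fps (a + 1) (b + 1) (c + 1)"
  by (rule fps_ext) (simp add: hyp2F1_fps_nth pochhammer_rec field_simps del: of_nat_Suc)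

text \<open>The derivative of F(a,b;c) is a multiple of F(a+1,b+1;c+1), so a primitive of the
  continuation of the latter continues the former.\<close>

lemma continuable_hyp2F1_fps_shift:
  assumes "continuable (hyp2F1_fps (a + 1) (b + 1) (c + 1))"
  shows   "continuable (hyp2F1_fps a b c)"
proof -
  define F where "F = hyp2F1_fps a b c"
  have "continuable (fps_deriv F)"
    unfolding F_def fps_deriv_hyp2F1_fps by (rule continuable_cmult) fact
  then obtain f where f: "f holomorphic_on cut_plane" "f has_fps_expansion fps_deriv F"
    by (auto simp: continuable_def)
  obtain g where g: "\<And>z. z \<in> cut_plane \<Longrightarrow> (g has_field_derivative f z) (at z)"
    using holomorphic_starlike_primitive[of cut_plane f "{}"] f(1) open_cut_plane starlike_cut_plane
    by (auto simp: holomorphic_on_imp_continuous_on holomorphic_on_imp_differentiable_at)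
  \<comment> \<open>The constant of integration is chosen to give the value 1 at 0, the constant
    term of the series.\<close>
  define h where "h = (\<lambda>z. g z - g 0 + 1)"
  have h: "(h has_field_derivative f z) (at z)" if "z \<in> cut_plane" for z
    using g[OF that] unfolding h_def by (auto intro!: derivative_eq_intros)
  have h_holo: "h holomorphic_on cut_plane"
    using h open_cut_plane holomorphic_on_open by blast
  define G where "G = fps_expansion h 0"
  have G: "h has_fps_expansion G"
    unfolding G_def using open_cut_plane zero_in_cut_plane h_holo by auto
  have "f has_fps_expansion fps_deriv G"
  proof -
    have "deriv h has_fps_expansion fps_deriv G" by (rule has_fps_expansion_deriv[OF G])
    moreover have "eventually (\<lambda>z. deriv h z = f z) (nhds 0)"
      using eventually_nhds_in_open[OF open_cut_plane zero_in_cut_plane]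
      by eventually_elim (use h DERIV_imp_deriv in blast)
    ultimately show ?thesis using has_fps_expansion_cong by blast
  qed
  hence "fps_deriv G = fps_deriv F"
    using f(2) fps_expansion_unique_complex by blast
  moreover have "fps_nth G 0 = fps_nth F 0"
    using has_fps_expansion_imp_0_eq_fps_nth_0[OF G] by (simp add: h_def F_def hyp2F1_fps_nth)
  ultimately have "G = F"
    by (auto simp: fps_deriv_eq_iff)
  with G h_holo show ?thesis by (auto simp: continuable_def F_def)
qed

text \<open>Two descents. For b > 1, lowering c by unit steps starts from a c with c - b > 1, where
  Euler's integral applies. A general b is then reached from b + m by simultaneous shifts; these
  preserve c - b, so the first descent has to cover every admissible c.\<close>

theorem continuable_hyp2F1_fps:
  fixes b c :: real
  assumes "c \<notin> \<int>\<^sub>\<le>\<^sub>0"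
  shows   "continuable (hyp2F1_fps a (of_real b) (of_real c))"
proof -
  have base: "continuable (hyp2F1_fps a (of_real b) (of_real c))"
    if "1 < b" "c \<notin> \<int>\<^sub>\<le>\<^sub>0" for a :: complex and b c :: real
  proof -
    have *: "continuable (hyp2F1_fps a (of_real b) (of_real c))"
      if "1 < c + real m - b" "c \<notin> \<int>\<^sub>\<le>\<^sub>0" for c m using that
    proof (induction m arbitrary: c)
      case 0
      thus ?case using \<open>1 < b\<close> by (intro continuable_hyp2F1_fps_euler) auto
    next
      case (Suc m)
      have "continuable (hyp2F1_fps a (of_real b) (of_real (c + 1)))"
        using Suc.prems by (intro Suc.IH) (use plus_one_in_nonpos_Ints_imp[of c] in auto)
      hence "continuable (hyp2F1_fps a (of_real b) (of_real c + 1))" by simp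
      thus ?case
        by (rule continuable_hyp2F1_fps_lower_c) (use Suc.prems in \<open>auto simp: of_real_in_nonpos_Ints_iff\<close>)
    qed
    obtain m :: nat where "real m > b + 1 - c"
      using reals_Archimedean2 by blast
    thus ?thesis using that by (intro *[of c m]) auto
  qed
  have *: "continuable (hyp2F1_fps a (of_real b) (of_real c))" if "1 < b + real m" for m
    using that assms
  proof (induction m arbitrary: a b c)
    case 0
    thus ?case by (intro base) auto
  next
    case (Suc m)
    have "continuable (hyp2F1_fps (a + 1) (of_real (b + 1)) (of_real (c + 1)))"
      using Suc.prems by (intro Suc.IH) (use plus_one_in_nonpos_Ints_imp[of c] in auto)
    hence "continuable (hyp2F1_fps (a + 1) (of_real b + 1) (of_real c + 1))" by simp
    thus ?case by (rule continuable_hyp2F1_fps_shift)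
  qed
  obtain m :: nat where "real m > 1 - b"
    using reals_Archimedean2 by blast
  thus ?thesis using assms by (intro *[of m]) auto
qed

text \<open>A continuation is holomorphic on the unit disc and so equals the sum of its Taylor
  series there. It is therefore a witness for the SOME in \<open>hyp2F1_def\<close>.\<close>

lemma
  assumes "continuable (hyp2F1_fps a b c)"
  shows holomorphic_hyp2F1: "hyp2F1 a b c holomorphic_on cut_plane"
    and hyp2F1_has_fps_expansion: "hyp2F1 a b c has_fps_expansion hyp2F1_fps a b c"
proof -
  obtain f where f: "f holomorphic_on cut_plane" "f has_fps_expansion hyp2F1_fps a b c"
    using assms by (auto simp: continuable_def)
  have sums: "(\<lambda>k. fps_nth (hyp2F1_fps a b c) k * z ^ k) sums f z" if "norm z < 1" for z
    using that f holomorphic_on_subset[OF f(1) ball_subset_cut_plane]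
    by (intro has_fps_expansion_imp_sums_complex[where r = 1]) (auto simp: one_ereal_def)
  hence "\<forall>z\<in>ball 0 1. f z = hyp2F1_series a b c z"
    by (auto simp: hyp2F1_series_def hyp2F1_fps_nth sums_iff)
  with f(1) have "\<exists>f. f holomorphic_on cut_plane \<and> (\<forall>z\<in>ball 0 1. f z = hyp2F1_series a b c z)"
    by blast
  from someI_ex[OF this]
  have *: "hyp2F1 a b c holomorphic_on cut_plane"
          "\<And>z. z \<in> ball 0 1 \<Longrightarrow> hyp2F1 a b c z = hyp2F1_series a b c z"
    unfolding hyp2F1_def [symmetric] by blast+
  show "hyp2F1 a b c holomorphic_on cut_plane" by fact
  show "hyp2F1 a b c has_fps_expansion hyp2F1_fps a b c"
    using * sums by (intro has_fps_expansion_sumsI[of 1]) (auto simp: hyp2F1_series_def hyp2F1_fps_nth sums_iff)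
qed


section \<open>Relations between hypergeometric power series\<close>

lemma hyp2F1_fps_nth_0 [simp]: "fps_nth (hyp2F1_fps a b c) 0 = 1"
  by (simp add: hyp2F1_fps_nth)

lemma hyp2F1_fps_nth_Suc:
  assumes "c \<notin> \<int>\<^sub>\<le>\<^sub>0"
  shows "(c + of_nat k) * of_nat (Suc k) * fps_nth (hyp2F1_fps a b c) (Suc k) =
           (a + of_nat k) * (b + of_nat k) * fps_nth (hyp2F1_fps a b c) k"
  using not_nonpos_Int_add_of_nat[OF assms, of k]
  by (simp add: hyp2F1_fps_nth pochhammer_Suc divide_simps del: of_nat_Suc)

lemma hyp2F1_fps_nth_Suc':
  assumes "c \<notin> \<int>\<^sub>\<le>\<^sub>0"
  shows "fps_nth (hyp2F1_fps a b c) (Suc k) =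
           (a + of_nat k) * (b + of_nat k) / ((c + of_nat k) * of_nat (Suc k)) *
           fps_nth (hyp2F1_fps a b c) k"
proof -
  have "(c + of_nat k) * of_nat (Suc k) \<noteq> 0"
    using not_nonpos_Int_add_of_nat[OF assms, of k] by (simp del: of_nat_Suc)
  thus ?thesis
    using hyp2F1_fps_nth_Suc[OF assms, of k a b] by (simp add: eq_divide_eq mult_ac del: of_nat_Suc)
qed

section \<open>The hypergeometric differential equation\<close>

lemma hypergeometric_ode_iff:
  fixes G :: "complex fps"
  shows "fps_X * (1 - fps_X) * fps_deriv (fps_deriv G) +
           (fps_const c - fps_const (a + b + 1) * fps_X) * fps_deriv G = fps_const (a * b) * G \<longleftrightarrow>
         (\<forall>k. (c + of_nat k) * of_nat (Suc k) * fps_nth G (Suc k) =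
                (a + of_nat k) * (b + of_nat k) * fps_nth G k)"
    (is "?L = ?R \<longleftrightarrow> _")
proof -
  \<comment> \<open>With the powers of x pulled to the front, each term is a coefficient shift; the
    indices 0 and 1 are separate cases because up to two factors x occur.\<close>
  have L: "?L = fps_X * fps_deriv (fps_deriv G) - fps_X * (fps_X * fps_deriv (fps_deriv G)) +
             fps_const c * fps_deriv G - fps_const (a + b + 1) * (fps_X * fps_deriv G)"
    by (simp add: algebra_simps)
  have "fps_nth ?L k - fps_nth ?R k =
          (c + of_nat k) * of_nat (Suc k) * fps_nth G (Suc k) -
          (a + of_nat k) * (b + of_nat k) * fps_nth G k" for k
  proof (cases k)
    case 0
    thus ?thesis unfolding L by simp
  next
    case (Suc j)
    thus ?thesis unfolding L by (cases j) (simp_all add: algebra_simps)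
  qed
  thus ?thesis
    by (metis (no_types, lifting) eq_iff_diff_eq_0 fps_ext)
qed

lemma hyp2F1_fps_ode:
  fixes a b c :: complex
  assumes "c \<notin> \<int>\<^sub>\<le>\<^sub>0"
  defines "F \<equiv> hyp2F1_fps a b c"
  shows "fps_X * (1 - fps_X) * fps_deriv (fps_deriv F) +
           (fps_const c - fps_const (a + b + 1) * fps_X) * fps_deriv F = fps_const (a * b) * F"
  unfolding hypergeometric_ode_iff F_def using hyp2F1_fps_nth_Suc[OF assms(1)] by blast

text \<open>Since c + k never vanishes, the coefficient recurrence determines each coefficient from
  the one before. A series is thus recognised as hypergeometric by its equation and constant
  term.\<close>

lemma hyp2F1_fps_unique:
  assumes "c \<notin> \<int>\<^sub>\<le>\<^sub>0" "fps_nth G 0 = 1"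
  assumes "fps_X * (1 - fps_X) * fps_deriv (fps_deriv G) +
           (fps_const c - fps_const (a + b + 1) * fps_X) * fps_deriv G = fps_const (a * b) * G"
  shows   "G = hyp2F1_fps a b c"
proof (rule fps_ext)
  fix k show "fps_nth G k = fps_nth (hyp2F1_fps a b c) k"
  proof (induction k)
    case (Suc k)
    have "(c + of_nat k) * of_nat (Suc k) * fps_nth G (Suc k) =
          (c + of_nat k) * of_nat (Suc k) * fps_nth (hyp2F1_fps a b c) (Suc k)"
      using assms(3) hyp2F1_fps_nth_Suc[OF assms(1)] Suc.IH
      by (simp add: hypergeometric_ode_iff del: of_nat_Suc)
    thus ?case
      using not_nonpos_Int_add_of_nat[OF assms(1), of k] by (simp del: of_nat_Suc)
  qed (use assms in auto)
qed

section \<open>The binomial series of (1 - x)^s and Euler's transformation\<close>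

definition one_minus_fps_powr :: "complex \<Rightarrow> complex fps" where
  "one_minus_fps_powr s = Abs_fps (\<lambda>k. pochhammer (- s) k / fact k)"

lemma one_minus_fps_powr_nth_0 [simp]: "fps_nth (one_minus_fps_powr s) 0 = 1"
  by (simp add: one_minus_fps_powr_def)

lemma one_minus_fps_powr_nth_Suc:
  "fps_nth (one_minus_fps_powr s) (Suc k) =
     (of_nat k - s) / of_nat (Suc k) * fps_nth (one_minus_fps_powr s) k"
  by (simp add: one_minus_fps_powr_def pochhammer_Suc mult_ac)

lemma one_minus_fps_powr_deriv:
  "(1 - fps_X) * fps_deriv (one_minus_fps_powr s) = - fps_const s * one_minus_fps_powr s"
proof (rule fps_ext)
  fix k
  have "of_nat (Suc k) * fps_nth (one_minus_fps_powr s) (Suc k) =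
          (of_nat k - s) * fps_nth (one_minus_fps_powr s) k"
    by (simp add: one_minus_fps_powr_nth_Suc del: of_nat_Suc)
  thus "fps_nth ((1 - fps_X) * fps_deriv (one_minus_fps_powr s)) k =
        fps_nth (- fps_const s * one_minus_fps_powr s) k"
    by (cases k) (simp_all add: algebra_simps)
qed

lemma one_minus_fps_powr_deriv2:
  "(1 - fps_X) * fps_deriv (fps_deriv (one_minus_fps_powr s)) =
     (1 - fps_const s) * fps_deriv (one_minus_fps_powr s)"
  using arg_cong[OF one_minus_fps_powr_deriv[of s], of fps_deriv]
  by (simp add: algebra_simps del: fps_const_neg)

text \<open>Reduces the exponent 3/2, which occurs in one Euler transformation and in the Wronskian,
  to the common exponent 1/2.\<close>

lemma one_minus_fps_powr_plus1:
  "one_minus_fps_powr (s + 1) = (1 - fps_X) * one_minus_fps_powr s"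
proof (rule fps_ext)
  fix k
  show "fps_nth (one_minus_fps_powr (s + 1)) k = fps_nth ((1 - fps_X) * one_minus_fps_powr s) k"
  proof (cases k)
    case (Suc j)
    have "pochhammer (- (s + 1)) (Suc j) = - (s + 1) * pochhammer (- s) j"
      by (simp add: pochhammer_rec)
    hence "fps_nth (one_minus_fps_powr (s + 1)) k =
             - (s + 1) / of_nat (Suc j) * fps_nth (one_minus_fps_powr s) j"
      unfolding Suc one_minus_fps_powr_def by simp
    also have "- (s + 1) / of_nat (Suc j) = (of_nat j - s) / of_nat (Suc j) - 1"
    proof -
      define N where "N = complex_of_nat (Suc j)"
      have "N \<noteq> 0" "complex_of_nat j = N - 1" unfolding N_def by (rule of_nat_neq_0) simp
      thus ?thesis unfolding N_def [symmetric] by (simp add: field_simps)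
    qed
    also have "\<dots> * fps_nth (one_minus_fps_powr s) j = fps_nth ((1 - fps_X) * one_minus_fps_powr s) k"
      unfolding Suc by (simp add: one_minus_fps_powr_nth_Suc left_diff_distrib del: of_nat_Suc)
    finally show ?thesis .
  qed (simp add: one_minus_fps_powr_def)
qed

lemma one_minus_fps_X_nonzero: "(1 - fps_X :: complex fps) \<noteq> 0"
  by (metis fps_nonzeroI fps_one_nth fps_sub_nth fps_X_nth diff_zero zero_neq_one)

lemma not_nonpos_Int_thirds:
  "(1/3 :: complex) \<notin> \<int>\<^sub>\<le>\<^sub>0" "(2/3 :: complex) \<notin> \<int>\<^sub>\<le>\<^sub>0" "(4/3 :: complex) \<notin> \<int>\<^sub>\<le>\<^sub>0"
  "(5/3 :: complex) \<notin> \<int>\<^sub>\<le>\<^sub>0" "(- 1/3 :: complex) \<notin> \<int>\<^sub>\<le>\<^sub>0" "- (1/3 :: complex) \<notin> \<int>\<^sub>\<le>\<^sub>0"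
proof -
  have *: "of_int k / 3 \<notin> (\<int>\<^sub>\<le>\<^sub>0 :: complex set)" if "\<not> 3 dvd k" for k
  proof
    assume "of_int k / 3 \<in> (\<int>\<^sub>\<le>\<^sub>0 :: complex set)"
    then obtain n where "of_int k / 3 = (of_int n :: complex)" by (elim nonpos_Ints_cases)
    hence "(of_int k :: complex) = of_int (3 * n)" by simp
    hence "k = 3 * n" by (simp only: of_int_eq_iff)
    with that show False by simp
  qed
  show "(1/3 :: complex) \<notin> \<int>\<^sub>\<le>\<^sub>0" "(2/3 :: complex) \<notin> \<int>\<^sub>\<le>\<^sub>0" "(4/3 :: complex) \<notin> \<int>\<^sub>\<le>\<^sub>0"
    "(5/3 :: complex) \<notin> \<int>\<^sub>\<le>\<^sub>0" "(- 1/3 :: complex) \<notin> \<int>\<^sub>\<le>\<^sub>0" "- (1/3 :: complex) \<notin> \<int>\<^sub>\<le>\<^sub>0"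
    using *[of 1] *[of 2] *[of 4] *[of 5] *[of "-1"] by simp_all
qed

text \<open>Derivatives are free ring elements here, so only polynomial algebra remains.
  \<open>S\<close> stands for (1 - x)^(c-a-b); the extra factor 1 - X on both sides supplies the
  second power needed to reduce \<open>S2\<close> to \<open>S\<close>.\<close>

lemma euler_transformation_aux:
  fixes A B C X S S1 S2 G G1 G2 :: "'a :: comm_ring_1"
  assumes S1: "(1 - X) * S1 = - (C - A - B) * S"
  assumes S2: "(1 - X) * S2 = (1 - (C - A - B)) * S1"
  assumes G: "X * (1 - X) * G2 + (C - (2 * C - A - B + 1) * X) * G1 = (C - A) * (C - B) * G"
  shows "(1 - X) * (X * (1 - X) * (S2 * G + 2 * S1 * G1 + S * G2) +
            (C - (A + B + 1) * X) * (S1 * G + S * G1)) = (1 - X) * (A * B * (S * G))"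
proof -
  define D P s where "D = 1 - X" and "P = C - (A + B + 1) * X" and "s = C - A - B"
  have S1: "D * S1 = - s * S" and S2: "D * S2 = (1 - s) * S1"
    using S1 S2 by (simp_all add: D_def s_def)
  have G: "X * D * G2 = (C - A) * (C - B) * G - (C - (2 * C - A - B + 1) * X) * G1"
    using G by (simp add: D_def eq_diff_eq)
  have "D * (X * D * (S2 * G + 2 * S1 * G1 + S * G2) + P * (S1 * G + S * G1)) =
          X * G * (D * (D * S2)) + 2 * X * G1 * D * (D * S1) + D * S * (X * D * G2) +
          P * G * (D * S1) + P * D * S * G1"
    by (simp add: algebra_simps)
  also have "D * (D * S2) = (1 - s) * (D * S1)"
    unfolding S2 by (simp add: algebra_simps)
  also have "X * G * ((1 - s) * (D * S1)) + 2 * X * G1 * D * (D * S1) + D * S * (X * D * G2) +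
          P * G * (D * S1) + P * D * S * G1 = D * (A * B * (S * G))"
    unfolding S1 G unfolding D_def P_def s_def by (simp add: algebra_simps)
  finally show ?thesis unfolding D_def P_def .
qed

text \<open>The product on the right solves the equation with parameters a, b, c and has constant
  term 1, so uniqueness applies.\<close>

lemma euler_transformation_fps:
  assumes "c \<notin> \<int>\<^sub>\<le>\<^sub>0"
  shows   "hyp2F1_fps a b c = one_minus_fps_powr (c - a - b) * hyp2F1_fps (c - a) (c - b) c"
proof -
  define S where "S = one_minus_fps_powr (c - a - b)"
  define G where "G = hyp2F1_fps (c - a) (c - b) c"
  have S1: "(1 - fps_X) * fps_deriv S = - (fps_const c - fps_const a - fps_const b) * S"
    unfolding S_def one_minus_fps_powr_deriv by simp
  have S2: "(1 - fps_X) * fps_deriv (fps_deriv S) =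
               (1 - (fps_const c - fps_const a - fps_const b)) * fps_deriv S"
    unfolding S_def one_minus_fps_powr_deriv2 by simp
  have const_eqs: "fps_const (c - a + (c - b) + 1) = 2 * fps_const c - fps_const a - fps_const b + 1"
       "fps_const ((c - a) * (c - b)) = (fps_const c - fps_const a) * (fps_const c - fps_const b)"
    by (simp_all add: numeral_fps_const)
  have G: "fps_X * (1 - fps_X) * fps_deriv (fps_deriv G) +
           (fps_const c - (2 * fps_const c - fps_const a - fps_const b + 1) * fps_X) * fps_deriv G =
           (fps_const c - fps_const a) * (fps_const c - fps_const b) * G"
    using hyp2F1_fps_ode[OF assms, of "c - a" "c - b"] unfolding const_eqs G_def .
  have d: "fps_deriv (S * G) = fps_deriv S * G + S * fps_deriv G"
          "fps_deriv (fps_deriv S * G + S * fps_deriv G) = fps_deriv (fps_deriv S) * G + 2 * fps_deriv S * fps_deriv G +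
             S * fps_deriv (fps_deriv G)"
    by (simp_all add: algebra_simps)
  have "S * G = hyp2F1_fps a b c"
  proof (rule hyp2F1_fps_unique[OF assms])
    show "fps_nth (S * G) 0 = 1" by (simp add: S_def G_def)
    note eq = euler_transformation_aux[OF S1 S2 G, unfolded mult_left_cancel[OF one_minus_fps_X_nonzero]]
    have "fps_const (a + b + 1) = fps_const a + fps_const b + 1"
         "fps_const (a * b) = fps_const a * fps_const b" by simp_all
    thus "fps_X * (1 - fps_X) * fps_deriv (fps_deriv (S * G)) +
      (fps_const c - fps_const (a + b + 1) * fps_X) * fps_deriv (S * G) = fps_const (a * b) * (S * G)"
      by (simp only: d eq)
  qed
  thus ?thesis by (simp add: S_def G_def)
qed

section \<open>Parameter shifts, the contiguous relation and the Wronskian\<close>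

lemma pochhammer_plus1: "a * pochhammer (a + 1) k = pochhammer a k * (a + of_nat k)"
  for a :: complex
  by (metis pochhammer_Suc pochhammer_rec)

lemma pochhammer_minus1_Suc: "pochhammer (a - 1) (Suc k) = (a - 1) * pochhammer a k"
  for a :: complex
  by (simp add: pochhammer_rec)

lemma hyp2F1_fps_lower_c:
  fixes a b c :: complex
  assumes "c \<notin> \<int>\<^sub>\<le>\<^sub>0" "c - 1 \<notin> \<int>\<^sub>\<le>\<^sub>0"
  defines "F \<equiv> hyp2F1_fps a b c"
  shows "fps_const (c - 1) * hyp2F1_fps a b (c - 1) = fps_const (c - 1) * F + fps_X * fps_deriv F"
proof (rule fps_ext)
  fix k
  have nz: "c - 1 \<noteq> 0" "pochhammer (c - 1) k \<noteq> 0" "pochhammer c k \<noteq> 0"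
    using assms by (auto simp: pochhammer_eq_0_iff)
  have "(c - 1) * pochhammer c k = pochhammer (c - 1) k * (c - 1 + of_nat k)"
    using pochhammer_plus1[of "c - 1" k] by simp
  hence "fps_nth (fps_const (c - 1) * hyp2F1_fps a b (c - 1)) k = (c - 1 + of_nat k) * fps_nth F k"
    using nz by (simp add: F_def hyp2F1_fps_nth divide_simps)
  thus "fps_nth (fps_const (c - 1) * hyp2F1_fps a b (c - 1)) k =
        fps_nth (fps_const (c - 1) * F + fps_X * fps_deriv F) k"
    by (cases k) (simp_all add: algebra_simps)
qed

text \<open>On the k-th coefficient of F the right-hand side acts as (b + k)(1 - (a + k)/(c + k)),
  which is (b + k)(c - a)/(c + k).\<close>

lemma hyp2F1_fps_raise_b_c:
  fixes a b c :: complex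
  assumes "c \<notin> \<int>\<^sub>\<le>\<^sub>0"
  defines "F \<equiv> hyp2F1_fps a b c"
  shows "fps_const (b * (c - a) / c) * hyp2F1_fps a (b + 1) (c + 1) =
           fps_const b * F - (1 - fps_X) * fps_deriv F"
proof (rule fps_ext)
  fix k
  have c: "c + of_nat k \<noteq> 0" by (rule not_nonpos_Int_add_of_nat) fact
  have "c \<noteq> 0" using assms by auto
  have p: "pochhammer c k \<noteq> 0" using assms by (auto simp: pochhammer_eq_0_iff)
  have "pochhammer (c + 1) k = pochhammer c k * (c + of_nat k) / c"
    using pochhammer_plus1[of c k] \<open>c \<noteq> 0\<close> by (simp add: field_simps)
  hence "fps_nth (fps_const (b * (c - a) / c) * hyp2F1_fps a (b + 1) (c + 1)) k =
          pochhammer a k * (b * pochhammer (b + 1) k) * (c - a) / (pochhammer c k * (c + of_nat k) * fact k)"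
    using \<open>c \<noteq> 0\<close> by (simp add: hyp2F1_fps_nth)
  also have "\<dots> = (b + of_nat k) * fps_nth F k * ((c - a) / (c + of_nat k))"
    unfolding pochhammer_plus1 by (simp add: F_def hyp2F1_fps_nth mult_ac)
  also have "\<dots> = (b + of_nat k) * fps_nth F k - of_nat (Suc k) * fps_nth F (Suc k)"
    using hyp2F1_fps_nth_Suc[OF assms(1), of k a b] c by (simp add: F_def field_simps del: of_nat_Suc)
  also have "\<dots> = fps_nth (fps_const b * F - (1 - fps_X) * fps_deriv F) k"
    by (cases k) (simp_all add: algebra_simps)
  finally show "fps_nth (fps_const (b * (c - a) / c) * hyp2F1_fps a (b + 1) (c + 1)) k = \<dots>" .
qed

text \<open>The coefficients of x^(j+1) on both sides are rational multiples of the j-th coefficient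
  of F, which leaves an identity of rational functions. Exchanging a and b gives the opposite
  shift.\<close>

lemma hyp2F1_fps_lower_a_raise_b:
  fixes a b c :: complex
  assumes "c \<notin> \<int>\<^sub>\<le>\<^sub>0"
  defines "F \<equiv> hyp2F1_fps a b c"
  shows "fps_const (b * (c - a)) * hyp2F1_fps (a - 1) (b + 1) c =
           fps_const (b - a + 1) * (fps_X * (1 - fps_X) * fps_deriv F) +
           fps_const b * (fps_const (c - a) - fps_const (b - a + 1) * fps_X) * F"
    (is "_ = ?R")
proof (rule fps_ext)
  fix k
  have R: "?R = fps_const (b - a + 1) * (fps_X * fps_deriv F) -
             fps_const (b - a + 1) * (fps_X * (fps_X * fps_deriv F)) +
             fps_const (b * (c - a)) * F - fps_const (b * (b - a + 1)) * (fps_X * F)"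
    by (simp add: algebra_simps)
  show "fps_nth (fps_const (b * (c - a)) * hyp2F1_fps (a - 1) (b + 1) c) k = fps_nth ?R k"
  proof (cases k)
    case 0
    thus ?thesis unfolding R by (simp add: F_def)
  next
    case (Suc j)
    have c: "c + of_nat j \<noteq> 0" by (rule not_nonpos_Int_add_of_nat) fact
    have p: "pochhammer c j \<noteq> 0" using assms by (auto simp: pochhammer_eq_0_iff)
    have "fps_nth (fps_const (b * (c - a)) * hyp2F1_fps (a - 1) (b + 1) c) k =
            (c - a) * (a - 1) * pochhammer a j * (b * pochhammer (b + 1) (Suc j)) / (pochhammer c (Suc j) * fact (Suc j))"
      unfolding Suc by (simp add: hyp2F1_fps_nth pochhammer_minus1_Suc del: fact_Suc)
    also have "\<dots> = (c - a) * (a - 1) * (b + of_nat j) * (b + of_nat (Suc j)) / ((c + of_nat j) * of_nat (Suc j)) * fps_nth F j"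
      unfolding pochhammer_plus1 by (simp add: F_def hyp2F1_fps_nth pochhammer_Suc mult_ac)
    also have "\<dots> = ((b - a + 1) * of_nat (Suc j) + b * (c - a)) * fps_nth F (Suc j) -
                    (b - a + 1) * (of_nat j + b) * fps_nth F j"
    proof -
      have F: "fps_nth F (Suc j) = (a + of_nat j) * (b + of_nat j) / ((c + of_nat j) * of_nat (Suc j)) * fps_nth F j"
        unfolding F_def by (rule hyp2F1_fps_nth_Suc'[OF assms(1)])
      have "(c - a) * (a - 1) * (b + of_nat j) * (b + of_nat (Suc j)) / ((c + of_nat j) * of_nat (Suc j)) =
            ((b - a + 1) * of_nat (Suc j) + b * (c - a)) * ((a + of_nat j) * (b + of_nat j) / ((c + of_nat j) * of_nat (Suc j))) -
                    (b - a + 1) * (of_nat j + b)"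
        using c of_nat_neq_0[of j, where 'a = complex]
        by (simp add: divide_simps del: of_nat_Suc) (simp add: algebra_simps)
      thus ?thesis unfolding F by (simp only: left_diff_distrib mult.assoc [symmetric])
    qed
    also have "\<dots> = (b - a + 1) * (of_nat (Suc j) * fps_nth F (Suc j)) -
                    (b - a + 1) * (of_nat j * fps_nth F j) +
                    b * (c - a) * fps_nth F (Suc j) - b * (b - a + 1) * fps_nth F j"
      by (simp add: algebra_simps)
    also have "\<dots> = fps_nth ?R k"
      unfolding R Suc by (cases j) simp_all
    finally show ?thesis .
  qed
qed

lemma hyp2F1_fps_commute: "hyp2F1_fps a b c = hyp2F1_fps b a c"
  by (simp add: hyp2F1_fps_def mult.commute)

text \<open>Expresses F(1/12,1/12;-1/3) through F(13/12,13/12;5/3). The slope of the linear factor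
  is forced by comparing the coefficients of x; the higher coefficients then agree as rational
  functions of the index.\<close>

lemma hyp2F1_fps_lower_a_b_c:
  fixes a b c :: complex
  assumes "c \<notin> \<int>\<^sub>\<le>\<^sub>0" "c - 2 \<notin> \<int>\<^sub>\<le>\<^sub>0" "c \<noteq> 1"
  defines "F \<equiv> hyp2F1_fps a b c"
  shows "fps_const (c - 1) * hyp2F1_fps (a - 1) (b - 1) (c - 2) =
           fps_X * (1 - fps_X) * fps_deriv F +
           (fps_const (c - 1) - fps_const (a + b - 1 - (a - 1) * (b - 1) / (c - 2)) * fps_X) * F"
    (is "_ = ?R")
proof (rule fps_ext)
  fix k
  define d where "d = a + b - 1 - (a - 1) * (b - 1) / (c - 2)"
  have R: "?R = fps_X * fps_deriv F - fps_X * (fps_X * fps_deriv F) + fps_const (c - 1) * F - fps_const d * (fps_X * F)"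
    by (simp add: d_def algebra_simps)
  show "fps_nth (fps_const (c - 1) * hyp2F1_fps (a - 1) (b - 1) (c - 2)) k = fps_nth ?R k"
  proof (cases k)
    case 0
    thus ?thesis unfolding R by (simp add: F_def)
  next
    case (Suc j)
    have c: "c + of_nat j \<noteq> 0" by (rule not_nonpos_Int_add_of_nat) fact
    have c2: "c - 2 \<noteq> 0" using assms by auto
    have p: "pochhammer c j \<noteq> 0" using assms by (auto simp: pochhammer_eq_0_iff)
    have c1: "c - 1 \<noteq> 0" "c - 1 + of_nat j \<noteq> 0"
      using not_nonpos_Int_add_of_nat[OF assms(2), of "Suc j"] assms(3) by (simp_all add: algebra_simps)
    have "pochhammer (c - 2) (Suc j) = (c - 2) * pochhammer (c - 1) j"
      using pochhammer_minus1_Suc[of "c - 1" j] by simp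
    moreover have "pochhammer (c - 1) j = (c - 1) * pochhammer c j / (c - 1 + of_nat j)"
      using pochhammer_plus1[of "c - 1" j] c1 by (simp add: field_simps)
    ultimately have pc: "pochhammer (c - 2) (Suc j) = (c - 2) * ((c - 1) * pochhammer c j / (c - 1 + of_nat j))"
      by simp
    have "fps_nth (fps_const (c - 1) * hyp2F1_fps (a - 1) (b - 1) (c - 2)) k =
            (a - 1) * (b - 1) / (c - 2) * (c - 1 + of_nat j) / of_nat (Suc j) * fps_nth F j"
      using c1 c2 p unfolding Suc
      by (simp add: hyp2F1_fps_nth F_def pochhammer_minus1_Suc pc divide_simps del: of_nat_Suc)
    also have "\<dots> = (of_nat (Suc j) + c - 1) * fps_nth F (Suc j) - (of_nat j + d) * fps_nth F j"
    proof -
      have F: "fps_nth F (Suc j) = (a + of_nat j) * (b + of_nat j) / ((c + of_nat j) * of_nat (Suc j)) * fps_nth F j"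
        unfolding F_def by (rule hyp2F1_fps_nth_Suc'[OF assms(1)])
      have "(a - 1) * (b - 1) / (c - 2) * (c - 1 + of_nat j) / of_nat (Suc j) =
            (of_nat (Suc j) + c - 1) * ((a + of_nat j) * (b + of_nat j) / ((c + of_nat j) * of_nat (Suc j))) - (of_nat j + d)"
        unfolding d_def using c c2 of_nat_neq_0[of j, where 'a = complex]
        by (simp add: divide_simps del: of_nat_Suc) (simp add: algebra_simps)
      thus ?thesis unfolding F by (simp only: left_diff_distrib mult.assoc [symmetric])
    qed
    also have "\<dots> = of_nat (Suc j) * fps_nth F (Suc j) - of_nat j * fps_nth F j +
                    (c - 1) * fps_nth F (Suc j) - d * fps_nth F j"
      by (simp add: algebra_simps)
    also have "\<dots> = fps_nth ?R k"
      unfolding R Suc by (cases j) simp_all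
    finally show ?thesis .
  qed
qed

text \<open>With parameters p - M and p + M the two neighbours arise by moving M up or down by one.
  Their expressions contain x(1 - x)F' with weights 2M + 1 and -(2M - 1), so that term can be
  eliminated.\<close>

lemma hyp2F1_fps_contiguous:
  fixes p M c :: complex
  assumes "c \<notin> \<int>\<^sub>\<le>\<^sub>0" "M \<noteq> 0" "2 * M + 1 \<noteq> 0" "2 * M - 1 \<noteq> 0"
  defines "a \<equiv> p - M" and "b \<equiv> p + M"
  shows "fps_const (- (b * (c - a)) / (2 * M * (2 * M + 1))) * hyp2F1_fps (a - 1) (b + 1) c =
           (fps_X - fps_const ((b * (c - a) / (2 * M + 1) + a * (c - b) / (2 * M - 1)) / (2 * M))) *
             hyp2F1_fps a b c -
           fps_const (- (a * (c - b)) / (2 * M * (2 * M - 1))) * hyp2F1_fps (a + 1) (b - 1) c"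
proof -
  define F F1 F2 where "F = hyp2F1_fps a b c" and "F1 = hyp2F1_fps (a - 1) (b + 1) c"
    and "F2 = hyp2F1_fps (a + 1) (b - 1) c"
  define D where "D = fps_X * (1 - fps_X) * fps_deriv F"
  have d: "b - a + 1 = 2 * M + 1" "a - b + 1 = - (2 * M - 1)" by (simp_all add: a_def b_def)
  have 1: "fps_const (b * (c - a)) * F1 =
             fps_const (2 * M + 1) * D + fps_const b * (fps_const (c - a) - fps_const (2 * M + 1) * fps_X) * F"
    using hyp2F1_fps_lower_a_raise_b[OF assms(1), of b a] by (simp only: F_def F1_def D_def d)
  have 2: "fps_const (a * (c - b)) * F2 =
             fps_const (- (2 * M - 1)) * D + fps_const a * (fps_const (c - b) - fps_const (- (2 * M - 1)) * fps_X) * F"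
    using hyp2F1_fps_lower_a_raise_b[OF assms(1), of a b]
    by (simp only: F_def F2_def D_def d hyp2F1_fps_commute[of _ a] hyp2F1_fps_commute[of _ "a + 1"])
  \<comment> \<open>Passing to coefficients turns the elimination into scalar algebra, where
    division by M and 2M +- 1 is available.\<close>
  have "fps_nth (fps_const (- (b * (c - a)) / (2 * M * (2 * M + 1))) * F1) k =
        fps_nth ((fps_X - fps_const ((b * (c - a) / (2 * M + 1) + a * (c - b) / (2 * M - 1)) / (2 * M))) * F -
           fps_const (- (a * (c - b)) / (2 * M * (2 * M - 1))) * F2) k" for k
  proof -
    define x f f1 f2 e where "x = fps_nth (fps_X * F) k" and "f = fps_nth F k" and "f1 = fps_nth F1 k"
      and "f2 = fps_nth F2 k" and "e = fps_nth D k"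
    have 1: "b * (c - a) * f1 = (2 * M + 1) * e + b * ((c - a) * f - (2 * M + 1) * x)"
      using arg_cong[OF 1, of "\<lambda>G. fps_nth G k"]
      by (simp add: x_def f_def f1_def e_def mult.assoc left_diff_distrib)
    have 2: "a * (c - b) * f2 = - (2 * M - 1) * e + a * ((c - b) * f + (2 * M - 1) * x)"
      using arg_cong[OF 2, of "\<lambda>G. fps_nth G k"]
      by (simp add: x_def f_def f2_def e_def mult.assoc left_diff_distrib)
    have "- (b * (c - a) * f1) / (2 * M * (2 * M + 1)) =
            x - ((b * (c - a) / (2 * M + 1) + a * (c - b) / (2 * M - 1)) / (2 * M)) * f +
              (a * (c - b) * f2) / (2 * M * (2 * M - 1))"
      unfolding 1 2 using assms(2-4) unfolding a_def b_def
      by (simp add: divide_simps) algebra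
    thus ?thesis
      by (simp add: left_diff_distrib x_def flip: f_def f1_def f2_def)
  qed
  thus ?thesis unfolding F_def F1_def F2_def by (rule fps_ext)
qed

text \<open>The expression W = (1 - C) f g + X (f g' - f' g) is x^C times the Wronskian of f and
  x^(1-C) g. The left-hand side is (1 - X) W', and the two equations remove the second derivatives.
  \<open>A\<close> stands for a + b and \<open>P\<close> for a b.\<close>

lemma wronskian_deriv_aux:
  fixes A C P X f f1 f2 g g1 g2 :: "'a :: comm_ring_1"
  assumes f: "X * (1 - X) * f2 + (C - (A + 1) * X) * f1 = P * f"
  assumes g: "X * (1 - X) * g2 + (2 - C - (A + 3 - 2 * C) * X) * g1 = (P + (1 - C) * (A + 1 - C)) * g"
  shows   "(1 - X) * ((1 - C) * (f1 * g + f * g1) + (f * g1 - f1 * g) + X * (f * g2 - f2 * g)) =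
           (A + 1 - C) * ((1 - C) * (f * g) + X * (f * g1 - f1 * g))"
proof -
  have f: "X * (1 - X) * f2 = P * f - (C - (A + 1) * X) * f1" using f by (simp add: eq_diff_eq)
  have g: "X * (1 - X) * g2 = (P + (1 - C) * (A + 1 - C)) * g - (2 - C - (A + 3 - 2 * C) * X) * g1"
    using g by (simp add: eq_diff_eq)
  have "(1 - X) * ((1 - C) * (f1 * g + f * g1) + (f * g1 - f1 * g) + X * (f * g2 - f2 * g)) =
        (1 - X) * ((1 - C) * (f1 * g + f * g1) + (f * g1 - f1 * g)) +
          (f * (X * (1 - X) * g2) - (X * (1 - X) * f2) * g)"
    by (simp add: algebra_simps)
  also have "\<dots> = (A + 1 - C) * ((1 - C) * (f * g) + X * (f * g1 - f1 * g))"
    unfolding f g by (simp add: algebra_simps)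
  finally show ?thesis .
qed

text \<open>Abel's identity for the solutions $f$ and $x^{1-c} g$ of the hypergeometric equation, with the
  power of $x$ cleared.\<close>

lemma hyp2F1_fps_wronskian:
  fixes a b c :: complex
  assumes "c \<notin> \<int>\<^sub>\<le>\<^sub>0" "2 - c \<notin> \<int>\<^sub>\<le>\<^sub>0"
  defines "f \<equiv> hyp2F1_fps a b c" and "g \<equiv> hyp2F1_fps (a - c + 1) (b - c + 1) (2 - c)"
  shows "one_minus_fps_powr (a + b + 1 - c) *
           (fps_const (1 - c) * (f * g) + fps_X * (f * fps_deriv g - fps_deriv f * g)) = fps_const (1 - c)"
proof -
  define A C P where "A = fps_const (a + b)" and "C = fps_const c" and "P = fps_const (a * b)"
  define S where "S = one_minus_fps_powr (a + b + 1 - c)"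
  define W where "W = (1 - C) * (f * g) + fps_X * (f * fps_deriv g - fps_deriv f * g)"
  have "fps_const (a + b + 1) = A + 1" by (simp add: A_def)
  hence f: "fps_X * (1 - fps_X) * fps_deriv (fps_deriv f) + (C - (A + 1) * fps_X) * fps_deriv f = P * f"
    using hyp2F1_fps_ode[OF assms(1), of a b] by (simp only: f_def C_def P_def)
  have "fps_const (a - c + 1 + (b - c + 1) + 1) = A + 3 - 2 * C"
       "fps_const (2 - c) = 2 - C"
       "fps_const ((a - c + 1) * (b - c + 1)) = P + (1 - C) * (A + 1 - C)"
    by (rule fps_ext; simp add: A_def C_def P_def numeral_fps_const algebra_simps)+
  hence g: "fps_X * (1 - fps_X) * fps_deriv (fps_deriv g) +
              (2 - C - (A + 3 - 2 * C) * fps_X) * fps_deriv g = (P + (1 - C) * (A + 1 - C)) * g"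
    using hyp2F1_fps_ode[OF assms(2), of "a - c + 1" "b - c + 1"] by (simp only: g_def)
  have [simp]: "fps_deriv C = 0" by (simp add: C_def)
  have "fps_deriv W = (1 - C) * (fps_deriv f * g + f * fps_deriv g) + (f * fps_deriv g - fps_deriv f * g) +
          fps_X * (f * fps_deriv (fps_deriv g) - fps_deriv (fps_deriv f) * g)"
    by (simp add: W_def algebra_simps)
  hence W: "(1 - fps_X) * fps_deriv W = (A + 1 - C) * W"
    using wronskian_deriv_aux[OF f g] by (simp only: W_def)
  have "fps_const (a + b + 1 - c) = A + 1 - C" by (simp add: A_def C_def)
  hence S: "(1 - fps_X) * fps_deriv S = - (A + 1 - C) * S"
    unfolding S_def one_minus_fps_powr_deriv by simp
  \<comment> \<open>The logarithmic derivatives of \<open>S\<close> and \<open>W\<close> are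
    opposite, so the product is constant and can be read off at 0.\<close>
  have "(1 - fps_X) * fps_deriv (S * W) = ((1 - fps_X) * fps_deriv S) * W + S * ((1 - fps_X) * fps_deriv W)"
    by (simp add: algebra_simps)
  also have "\<dots> = 0"
    unfolding S W by (simp add: algebra_simps)
  finally have "fps_deriv (S * W) = 0"
    using one_minus_fps_X_nonzero by (simp only: mult_eq_0_iff simp_thms)
  hence "S * W = fps_const (fps_nth (S * W) 0)"
    by (simp only: fps_deriv_eq_0_iff)
  also have "fps_nth (S * W) 0 = 1 - c"
    by (simp add: S_def W_def f_def g_def C_def)
  finally have "S * W = fps_const (1 - c)" .
  moreover have "fps_const (1 - c) = 1 - C" by (simp add: C_def)
  ultimately show ?thesis
    by (simp only: S_def W_def)
qed

section \<open>Atkin polynomials\<close>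

definition C_coeff_fps :: "complex fps" where
  "C_coeff_fps = fps_const (- (1/60)) * (24 * hyp2F1_fps (- 5/12) (- 5/12) (- 1/3) +
                   hyp2F1_fps (- 5/12) (- 5/12) (2/3))"

definition D_coeff_fps :: "complex fps" where
  "D_coeff_fps = fps_const (91/384) * fps_X * (4 * hyp2F1_fps (- 1/12) (- 1/12) (1/3) -
                   5 * hyp2F1_fps (11/12) (- 1/12) (4/3))"

context
  fixes f g S :: "complex fps"
  defines "f \<equiv> hyp2F1_fps (5/12) (5/12) (1/3)"
    and   "g \<equiv> hyp2F1_fps (13/12) (13/12) (5/3)"
    and   "S \<equiv> one_minus_fps_powr (1/2)"
begin

text \<open>The Wronskian identity for a = b = 5/12 and c = 1/3, where the companion solution is
  \<open>g\<close> and the exponent is 3/2; a factor 3 clears denominators.\<close>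

lemma wronskian_f_g: "S * (1 - fps_X) * (2 * (f * g) + 3 * (fps_X * (f * fps_deriv g - fps_deriv f * g))) = 2"
proof -
  have "(one_minus_fps_powr (1/2 + 1)) *
          (fps_const (2/3) * (f * g) + fps_X * (f * fps_deriv g - fps_deriv f * g)) = fps_const (2/3)"
    using hyp2F1_fps_wronskian[of "1/3" "5/12" "5/12"] not_nonpos_Int_thirds by (simp add: f_def g_def)
  hence "fps_const 3 * (S * (1 - fps_X) * 
          (fps_const (2/3) * (f * g) + fps_X * (f * fps_deriv g - fps_deriv f * g))) = fps_const 3 * fps_const (2/3)"
    unfolding one_minus_fps_powr_plus1 S_def by (simp only: mult_ac)
  also have "fps_const 3 * (S * (1 - fps_X) * 
          (fps_const (2/3) * (f * g) + fps_X * (f * fps_deriv g - fps_deriv f * g))) =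
          S * (1 - fps_X) * ((fps_const 3 * fps_const (2/3)) * (f * g) + 
          fps_const 3 * (fps_X * (f * fps_deriv g - fps_deriv f * g)))"
    by (simp only: algebra_simps)
  finally show ?thesis by (simp add: numeral_fps_const)
qed

text \<open>Euler's transformation extracts (1 - x)^(1/2) and (1 - x)^(3/2); the remaining series
  \<open>h1\<close> and \<open>h2\<close> are parameter shifts of \<open>g\<close>.\<close>

lemma C_coeff_fps_eq: "48 * C_coeff_fps = S * ((35 * fps_X - 20) * g - 30 * (fps_X * (1 - fps_X) * fps_deriv g))"
proof -
  define h1 h2 where "h1 = hyp2F1_fps (1/12) (1/12) (- 1/3)" and "h2 = hyp2F1_fps (13/12) (13/12) (2/3)"
  have p1: "hyp2F1_fps (- 5/12) (- 5/12) (- 1/3) = S * h1"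
    using euler_transformation_fps[of "- 1/3" "- 5/12" "- 5/12"] not_nonpos_Int_thirds
    by (simp add: S_def h1_def)
  have p2: "hyp2F1_fps (- 5/12) (- 5/12) (2/3) = (1 - fps_X) * S * h2"
    using euler_transformation_fps[of "2/3" "- 5/12" "- 5/12"] one_minus_fps_powr_plus1[of "1/2"]
      not_nonpos_Int_thirds by (simp add: S_def h2_def)
  have "fps_const (2/3) * h1 = fps_X * (1 - fps_X) * fps_deriv g +
          (fps_const (2/3) - fps_const (19/16) * fps_X) * g"
    using hyp2F1_fps_lower_a_b_c[of "5/3" "13/12" "13/12"] not_nonpos_Int_thirds
    by (simp add: h1_def g_def)
  hence "fps_const 48 * (fps_const (2/3) * h1) = fps_const 48 * (fps_X * (1 - fps_X) * fps_deriv g +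
          (fps_const (2/3) - fps_const (19/16) * fps_X) * g)" by (simp only:)
  also have "\<dots> = fps_const 48 * (fps_X * (1 - fps_X) * fps_deriv g) +
          (fps_const 48 * fps_const (2/3) - (fps_const 48 * fps_const (19/16)) * fps_X) * g"
    by (simp only: algebra_simps)
  finally have h1: "32 * h1 = 48 * (fps_X * (1 - fps_X) * fps_deriv g) + (32 - 57 * fps_X) * g"
    by (simp add: numeral_fps_const flip: mult.assoc)
  have "fps_const (2/3) * h2 = fps_const (2/3) * g + fps_X * fps_deriv g"
    using hyp2F1_fps_lower_c[of "5/3" "13/12" "13/12"] not_nonpos_Int_thirds
    by (simp add: h2_def g_def)
  hence "fps_const 3 * (fps_const (2/3) * h2) = fps_const 3 * (fps_const (2/3) * g + fps_X * fps_deriv g)"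
    by (simp only:)
  also have "\<dots> = (fps_const 3 * fps_const (2/3)) * g + fps_const 3 * (fps_X * fps_deriv g)"
    by (simp only: algebra_simps)
  finally have h2: "2 * h2 = 2 * g + 3 * (fps_X * fps_deriv g)"
    by (simp add: numeral_fps_const flip: mult.assoc)
  have "60 * C_coeff_fps = (fps_const 60 * fps_const (- (1/60))) * (24 * (S * h1) + (1 - fps_X) * S * h2)"
    by (simp only: C_coeff_fps_def p1 p2 numeral_fps_const mult.assoc)
  also have "fps_const 60 * fps_const (- (1/60)) = (- 1 :: complex fps)" by simp
  \<comment> \<open>The factor 32 makes \<open>32 * h1\<close> and \<open>2 * h2\<close> appear;
    since 32 * 60 = 40 * 48, a factor 40 cancels at the end.\<close>
  finally have "32 * (60 * C_coeff_fps) = 32 * (- 1 * (24 * (S * h1) + (1 - fps_X) * S * h2))"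
    by (simp only:)
  also have "\<dots> = - (24 * S * (32 * h1) + 16 * (1 - fps_X) * S * (2 * h2))"
    by (simp add: algebra_simps)
  also have "\<dots> = 40 * (S * ((35 * fps_X - 20) * g - 30 * (fps_X * (1 - fps_X) * fps_deriv g)))"
    unfolding h1 h2 by (simp add: algebra_simps)
  finally have "40 * (48 * C_coeff_fps) = \<dots>" by simp
  thus ?thesis by (subst (asm) mult_left_cancel) simp_all
qed

text \<open>Both Euler transformations have exponent 1/2, and F(5/12,17/12;4/3) is a shift of
  \<open>f\<close>.\<close>

lemma D_coeff_fps_eq: "16 * D_coeff_fps = 91 * (fps_X * S * (f - 2 * ((1 - fps_X) * fps_deriv f)))"
proof -
  define f2 where "f2 = hyp2F1_fps (5/12) (17/12) (4/3)"
  have q1: "hyp2F1_fps (- 1/12) (- 1/12) (1/3) = S * f"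
    using euler_transformation_fps[of "1/3" "- 1/12" "- 1/12"] not_nonpos_Int_thirds
    by (simp add: S_def f_def)
  have q2: "hyp2F1_fps (11/12) (- 1/12) (4/3) = S * f2"
    using euler_transformation_fps[of "4/3" "11/12" "- 1/12"] not_nonpos_Int_thirds
    by (simp add: S_def f2_def)
  have "fps_const (- 5/48) * f2 = fps_const (5/12) * f - (1 - fps_X) * fps_deriv f"
    using hyp2F1_fps_raise_b_c[of "1/3" "5/12" "5/12"] not_nonpos_Int_thirds
    by (simp add: f2_def f_def)
  hence "fps_const (- 48) * (fps_const (- 5/48) * f2) =
           fps_const (- 48) * (fps_const (5/12) * f - (1 - fps_X) * fps_deriv f)" by (simp only:)
  also have "\<dots> = (fps_const (- 48) * fps_const (5/12)) * f - fps_const (- 48) * ((1 - fps_X) * fps_deriv f)"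
    by (simp only: algebra_simps)
  finally have f2: "5 * f2 = 48 * ((1 - fps_X) * fps_deriv f) - 20 * f"
    by (simp add: numeral_fps_const fps_const_neg [symmetric] del: fps_const_neg flip: mult.assoc)
  have "384 * D_coeff_fps = (fps_const 384 * fps_const (91/384)) * fps_X * (4 * (S * f) - 5 * (S * f2))"
    by (simp only: D_coeff_fps_def q1 q2 numeral_fps_const mult.assoc)
  also have "fps_const 384 * fps_const (91/384) = (91 :: complex fps)" by (simp add: numeral_fps_const)
  also have "91 * fps_X * (4 * (S * f) - 5 * (S * f2)) = 91 * fps_X * S * (4 * f - 5 * f2)"
    by (simp add: algebra_simps)
  also have "\<dots> = 24 * (91 * (fps_X * S * (f - 2 * ((1 - fps_X) * fps_deriv f))))"
    unfolding f2 by (simp add: algebra_simps)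
  finally have "24 * (16 * D_coeff_fps) = \<dots>" by simp
  thus ?thesis by (subst (asm) mult_left_cancel) simp_all
qed

text \<open>With these weights f g' and f' g enter only through their difference, and the
  coefficient 20x - 20 of f g contains the factor 1 - x. What remains is a constant multiple of the
  Wronskian expression.\<close>

lemma C_D_coeff_fps_combination_0: "12 * (91 * (C_coeff_fps * f) - 5 * (D_coeff_fps * g)) = - 455"
proof -
  have "4 * (12 * (91 * (C_coeff_fps * f) - 5 * (D_coeff_fps * g))) = 91 * f * (48 * C_coeff_fps) - 15 * g * (16 * D_coeff_fps)"
    by (simp add: algebra_simps)
  also have "\<dots> = - 910 * (S * (1 - fps_X) * (2 * (f * g) + 3 * (fps_X * (f * fps_deriv g - fps_deriv f * g))))"
    unfolding C_coeff_fps_eq D_coeff_fps_eq by (simp add: algebra_simps)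
  also have "\<dots> = 4 * (- 455)" unfolding wronskian_f_g by simp
  finally show ?thesis by (subst (asm) mult_left_cancel) simp_all
qed

text \<open>After all four factors are written in f, f', g, g', the products f' g' cancel and the
  rest is 12x - 5 times the Wronskian expression.\<close>

lemma C_D_coeff_fps_combination_1:
  "12 * (C_coeff_fps * hyp2F1_fps (- 7/12) (17/12) (1/3) + D_coeff_fps * hyp2F1_fps (1/12) (25/12) (5/3)) = 12 * fps_X - 5"
proof -
  define u y where "u = hyp2F1_fps (- 7/12) (17/12) (1/3)" and "y = hyp2F1_fps (1/12) (25/12) (5/3)"
  have "fps_const (- 5/144) * u = fps_X * (1 - fps_X) * fps_deriv f +
          fps_const (5/12) * (fps_const (- 1/12) - fps_X) * f"
    using hyp2F1_fps_lower_a_raise_b[of "1/3" "5/12" "5/12"] not_nonpos_Int_thirds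
    by (simp add: u_def f_def)
  hence "fps_const (- 144) * (fps_const (- 5/144) * u) = fps_const (- 144) * (fps_X * (1 - fps_X) * fps_deriv f +
          fps_const (5/12) * (fps_const (- 1/12) - fps_X) * f)" by (simp only:)
  also have "\<dots> = fps_const (- 144) * (fps_X * (1 - fps_X) * fps_deriv f) +
      ((fps_const (- 144) * fps_const (5/12) * fps_const (- 1/12)) - (fps_const (- 144) * fps_const (5/12)) * fps_X) * f"
    by (simp only: algebra_simps)
  finally have u: "5 * u = (5 + 60 * fps_X) * f - 144 * (fps_X * (1 - fps_X) * fps_deriv f)"
    by (simp add: numeral_fps_const fps_const_neg [symmetric] del: fps_const_neg flip: mult.assoc)
  have "fps_const (91/144) * y = fps_X * (1 - fps_X) * fps_deriv g +
          fps_const (13/12) * (fps_const (7/12) - fps_X) * g"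
    using hyp2F1_fps_lower_a_raise_b[of "5/3" "13/12" "13/12"] not_nonpos_Int_thirds
    by (simp add: y_def g_def)
  hence "fps_const 144 * (fps_const (91/144) * y) = fps_const 144 * (fps_X * (1 - fps_X) * fps_deriv g +
          fps_const (13/12) * (fps_const (7/12) - fps_X) * g)" by (simp only:)
  also have "\<dots> = fps_const 144 * (fps_X * (1 - fps_X) * fps_deriv g) +
      ((fps_const 144 * fps_const (13/12) * fps_const (7/12)) - (fps_const 144 * fps_const (13/12)) * fps_X) * g"
    by (simp only: algebra_simps)
  finally have y: "91 * y = (91 - 156 * fps_X) * g + 144 * (fps_X * (1 - fps_X) * fps_deriv g)"
    by (simp add: numeral_fps_const flip: mult.assoc)
  \<comment> \<open>The multiplier satisfies 1820 * 12 = 91 * 48 * 5 = 15 * 16 * 91, so all four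
    integral forms can be substituted.\<close>
  have "1820 * (12 * (C_coeff_fps * u + D_coeff_fps * y)) = 91 * (48 * C_coeff_fps) * (5 * u) + 15 * (16 * D_coeff_fps) * (91 * y)"
    by (simp add: algebra_simps)
  also have "\<dots> = 910 * ((12 * fps_X - 5) * (S * (1 - fps_X) *
      (2 * (f * g) + 3 * (fps_X * (f * fps_deriv g - fps_deriv f * g)))))"
    unfolding C_coeff_fps_eq D_coeff_fps_eq u y by (simp add: algebra_simps)
  also have "\<dots> = 1820 * (12 * fps_X - 5)" unfolding wronskian_f_g by simp
  finally show ?thesis unfolding u_def y_def by (subst (asm) mult_left_cancel) simp_all
qed

end

section \<open>The three-term recurrences for the U and Y series\<close>

text \<open>The parameters are centred at the index $n + 1$, so that the recurrence of the Atkin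
  polynomials at an index $m$ is the contiguous relation around $p - m$ and $p + m$.\<close>

definition U_scale :: "nat \<Rightarrow> complex" where
  "U_scale n = (- 1) ^ n * pochhammer (11/12) n * pochhammer (17/12) n / pochhammer 2 (2 * n)"

definition Y_scale :: "nat \<Rightarrow> complex" where
  "Y_scale n = (- 1) ^ n * pochhammer (19/12) n * pochhammer (25/12) n / pochhammer 2 (2 * n)"

definition U_tilde_fps :: "nat \<Rightarrow> complex fps" where
  "U_tilde_fps n = fps_const (U_scale n) *
     hyp2F1_fps (5/12 - of_nat (Suc n)) (5/12 + of_nat (Suc n)) (1/3)"

definition Y_tilde_fps :: "nat \<Rightarrow> complex fps" where
  "Y_tilde_fps n = fps_const (Y_scale n) *
     hyp2F1_fps (13/12 - of_nat (Suc n)) (13/12 + of_nat (Suc n)) (5/3)"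

text \<open>The step from 2n to 2n + 2 in (2)_{2n} contributes (2n + 2)(2n + 3), which is 2M(2M +
  1).\<close>

lemma U_scale_Suc:
  assumes "M = of_nat (Suc n)"
  shows   "U_scale (Suc n) = - ((M - 1/12) * (M + 5/12)) / (2 * M * (2 * M + 1)) * U_scale n"
  unfolding U_scale_def assms by (simp add: pochhammer_Suc algebra_simps)

lemma Y_scale_Suc:
  assumes "M = of_nat (Suc n)"
  shows   "Y_scale (Suc n) = - ((M + 7/12) * (M + 13/12)) / (2 * M * (2 * M + 1)) * Y_scale n"
  unfolding Y_scale_def assms by (simp add: pochhammer_Suc algebra_simps)

text \<open>Carries a contiguous relation over to rescaled series. Here \<open>k1\<close>,
  \<open>k\<close>, \<open>k2\<close> are the scales at three consecutive indices, so only scalar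
  identities between neighbouring scales remain.\<close>

lemma scaled_contiguous:
  fixes F F1 F2 :: "complex fps"
  assumes "fps_const \<mu> * F1 = (fps_X - fps_const \<beta>) * F - fps_const \<nu> * F2"
  assumes "k1 = k * \<mu>" "k * \<nu> = l * k2" "\<beta> = \<beta>'"
  shows   "fps_const k1 * F1 = (fps_X - fps_const \<beta>') * (fps_const k * F) - fps_const l * (fps_const k2 * F2)"
proof -
  have "fps_const k1 * F1 = fps_const k * (fps_const \<mu> * F1)"
    unfolding assms(2) by (simp flip: mult.assoc)
  also have "\<dots> = (fps_X - fps_const \<beta>) * (fps_const k * F) - (fps_const k * fps_const \<nu>) * F2"
    unfolding assms(1) by (simp only: right_diff_distrib mult_ac)
  also have "fps_const k * fps_const \<nu> = fps_const l * fps_const k2"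
    using assms(3) by simp
  finally show ?thesis using assms(4) by (simp only: mult.assoc)
qed

lemma atkin_index_nonzero:
  fixes j :: nat
  defines "M \<equiv> of_nat (Suc j) :: complex"
  shows "M \<noteq> 0" "2 * M + 1 \<noteq> 0" "2 * M - 1 \<noteq> 0"
proof -
  have "2 * M + 1 = of_nat (2 * j + 3)" "2 * M - 1 = of_nat (2 * j + 1)"
    by (simp_all add: M_def)
  thus "2 * M + 1 \<noteq> 0" "2 * M - 1 \<noteq> 0" by (simp_all only: of_nat_eq_0_iff)
  show "M \<noteq> 0" unfolding M_def by (rule of_nat_neq_0)
qed

definition atkin_b :: "complex \<Rightarrow> complex" where
  "atkin_b M = 2 * (M\<^sup>2 - 29/144) / (4 * M\<^sup>2 - 1)"

definition atkin_c :: "complex \<Rightarrow> complex" where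
  "atkin_c M = (M - 13/12) * (M - 7/12) * (M - 5/12) * (M + 1/12) /
                 (2 * M * (2 * M - 1)\<^sup>2 * (2 * M - 2))"

text \<open>The U and Y families yield the same diagonal coefficient; this is half of why they share
  one recurrence.\<close>

lemma atkin_b_u:
  assumes "M \<noteq> 0" "2 * M + 1 \<noteq> 0" "2 * M - 1 \<noteq> 0"
  shows "((5/12 + M) * (1/3 - (5/12 - M)) / (2 * M + 1) +
          (5/12 - M) * (1/3 - (5/12 + M)) / (2 * M - 1)) / (2 * M) = atkin_b M"
proof -
  define s t where "s = 2 * M + 1" and "t = 2 * M - 1"
  have "(5/12 + M) * (1/3 - (5/12 - M)) / s + (5/12 - M) * (1/3 - (5/12 + M)) / t =
          ((5/12 + M) * (1/3 - (5/12 - M)) * t + (5/12 - M) * (1/3 - (5/12 + M)) * s) / (s * t)"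
    using assms by (intro add_frac_eq) (simp_all add: s_def t_def)
  also have "(5/12 + M) * (1/3 - (5/12 - M)) * t + (5/12 - M) * (1/3 - (5/12 + M)) * s =
               2 * M * (2 * (M\<^sup>2 - 29/144))"
    by (simp add: s_def t_def field_simps power2_eq_square)
  also have "s * t = 4 * M\<^sup>2 - 1"
    by (simp add: s_def t_def algebra_simps power2_eq_square)
  finally show ?thesis using assms(1) by (simp add: atkin_b_def s_def t_def)
qed

lemma atkin_b_y:
  assumes "M \<noteq> 0" "2 * M + 1 \<noteq> 0" "2 * M - 1 \<noteq> 0"
  shows "((13/12 + M) * (5/3 - (13/12 - M)) / (2 * M + 1) +
          (13/12 - M) * (5/3 - (13/12 + M)) / (2 * M - 1)) / (2 * M) = atkin_b M"
proof -
  define s t where "s = 2 * M + 1" and "t = 2 * M - 1"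
  have "(13/12 + M) * (5/3 - (13/12 - M)) / s + (13/12 - M) * (5/3 - (13/12 + M)) / t =
          ((13/12 + M) * (5/3 - (13/12 - M)) * t + (13/12 - M) * (5/3 - (13/12 + M)) * s) / (s * t)"
    using assms by (intro add_frac_eq) (simp_all add: s_def t_def)
  also have "(13/12 + M) * (5/3 - (13/12 - M)) * t + (13/12 - M) * (5/3 - (13/12 + M)) * s =
               2 * M * (2 * (M\<^sup>2 - 29/144))"
    by (simp add: s_def t_def field_simps power2_eq_square)
  also have "s * t = 4 * M\<^sup>2 - 1"
    by (simp add: s_def t_def algebra_simps power2_eq_square)
  finally show ?thesis using assms(1) by (simp add: atkin_b_def s_def t_def)
qed

text \<open>The scale absorbs the leading factor of the contiguous relation and makes the recurrence
  monic. In \<open>atkin_c\<close>, the factors (M - 13/12)(M - 7/12) come from the scale and (M -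
  5/12)(M + 1/12) from the contiguous relation.\<close>

lemma U_tilde_fps_rec:
  fixes j :: nat
  defines "M \<equiv> of_nat (Suc (Suc j))"
  shows "U_tilde_fps (Suc (Suc j)) =
    (fps_X - fps_const (atkin_b M)) * U_tilde_fps (Suc j) - fps_const (atkin_c M) * U_tilde_fps j"
proof -
  note nz = atkin_index_nonzero[of "Suc j", folded M_def]
  have M': "M - 1 = of_nat (Suc j)" by (simp add: M_def)
  have nz': "2 * M - 2 \<noteq> 0"
    using of_nat_neq_0[of j, where 'a = complex] unfolding M' [symmetric] by simp
  have c: "fps_const (- ((5/12 + M) * (1/3 - (5/12 - M))) / (2 * M * (2 * M + 1))) *
               hyp2F1_fps (5/12 - M - 1) (5/12 + M + 1) (1/3) =
             (fps_X - fps_const (atkin_b M)) * hyp2F1_fps (5/12 - M) (5/12 + M) (1/3) -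
             fps_const (- ((5/12 - M) * (1/3 - (5/12 + M))) / (2 * M * (2 * M - 1))) *
               hyp2F1_fps (5/12 - M + 1) (5/12 + M - 1) (1/3)"
    using hyp2F1_fps_contiguous[OF not_nonpos_Int_thirds(1) nz, of "5/12"]
    unfolding atkin_b_u[OF nz] .
  have "U_scale (Suc (Suc j)) = U_scale (Suc j) * (- ((5/12 + M) * (1/3 - (5/12 - M))) / (2 * M * (2 * M + 1)))"
    by (subst U_scale_Suc[of M]) (simp_all add: M_def algebra_simps)
  moreover have "U_scale (Suc j) * (- ((5/12 - M) * (1/3 - (5/12 + M))) / (2 * M * (2 * M - 1))) =
                   atkin_c M * U_scale j"
  proof -
    have "U_scale (Suc j) = - ((M - 13/12) * (M - 7/12)) / ((2 * M - 2) * (2 * M - 1)) * U_scale j"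
      using U_scale_Suc[of "M - 1" j, OF M'] by (simp add: algebra_simps)
    thus ?thesis
      unfolding atkin_c_def using nz nz' by (simp add: divide_simps) algebra
  qed
  ultimately have "fps_const (U_scale (Suc (Suc j))) * hyp2F1_fps (5/12 - M - 1) (5/12 + M + 1) (1/3) =
      (fps_X - fps_const (atkin_b M)) * (fps_const (U_scale (Suc j)) * hyp2F1_fps (5/12 - M) (5/12 + M) (1/3)) -
      fps_const (atkin_c M) * (fps_const (U_scale j) * hyp2F1_fps (5/12 - M + 1) (5/12 + M - 1) (1/3))"
    by (rule scaled_contiguous[OF c _ _ refl])
  moreover have "5/12 - M - 1 = 5/12 - of_nat (Suc (Suc (Suc j)))" "5/12 + M + 1 = 5/12 + of_nat (Suc (Suc (Suc j)))"
    "5/12 - M + 1 = 5/12 - of_nat (Suc j)" "5/12 + M - 1 = 5/12 + of_nat (Suc j)"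
    by (simp_all add: M_def)
  ultimately show ?thesis unfolding U_tilde_fps_def by (simp only: M_def)
qed

text \<open>The same argument as for U, with the two pairs of factors of \<open>atkin_c\<close>
  exchanging their origin.\<close>

lemma Y_tilde_fps_rec:
  fixes j :: nat
  defines "M \<equiv> of_nat (Suc (Suc j))"
  shows "Y_tilde_fps (Suc (Suc j)) =
    (fps_X - fps_const (atkin_b M)) * Y_tilde_fps (Suc j) - fps_const (atkin_c M) * Y_tilde_fps j"
proof -
  note nz = atkin_index_nonzero[of "Suc j", folded M_def]
  have M': "M - 1 = of_nat (Suc j)" by (simp add: M_def)
  have nz': "2 * M - 2 \<noteq> 0"
    using of_nat_neq_0[of j, where 'a = complex] unfolding M' [symmetric] by simp
  have c: "fps_const (- ((13/12 + M) * (5/3 - (13/12 - M))) / (2 * M * (2 * M + 1))) *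
               hyp2F1_fps (13/12 - M - 1) (13/12 + M + 1) (5/3) =
             (fps_X - fps_const (atkin_b M)) * hyp2F1_fps (13/12 - M) (13/12 + M) (5/3) -
             fps_const (- ((13/12 - M) * (5/3 - (13/12 + M))) / (2 * M * (2 * M - 1))) *
               hyp2F1_fps (13/12 - M + 1) (13/12 + M - 1) (5/3)"
    using hyp2F1_fps_contiguous[OF not_nonpos_Int_thirds(4) nz, of "13/12"]
    unfolding atkin_b_y[OF nz] .
  have "Y_scale (Suc (Suc j)) = Y_scale (Suc j) * (- ((13/12 + M) * (5/3 - (13/12 - M))) / (2 * M * (2 * M + 1)))"
    by (subst Y_scale_Suc[of M]) (simp_all add: M_def algebra_simps)
  moreover have "Y_scale (Suc j) * (- ((13/12 - M) * (5/3 - (13/12 + M))) / (2 * M * (2 * M - 1))) =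
                   atkin_c M * Y_scale j"
  proof -
    have "Y_scale (Suc j) = - ((M - 5/12) * (M + 1/12)) / ((2 * M - 2) * (2 * M - 1)) * Y_scale j"
      using Y_scale_Suc[of "M - 1" j, OF M'] by (simp add: algebra_simps)
    thus ?thesis
      unfolding atkin_c_def using nz nz' by (simp add: divide_simps) algebra
  qed
  ultimately have "fps_const (Y_scale (Suc (Suc j))) * hyp2F1_fps (13/12 - M - 1) (13/12 + M + 1) (5/3) =
      (fps_X - fps_const (atkin_b M)) * (fps_const (Y_scale (Suc j)) * hyp2F1_fps (13/12 - M) (13/12 + M) (5/3)) -
      fps_const (atkin_c M) * (fps_const (Y_scale j) * hyp2F1_fps (13/12 - M + 1) (13/12 + M - 1) (5/3))"
    by (rule scaled_contiguous[OF c _ _ refl])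
  moreover have "13/12 - M - 1 = 13/12 - of_nat (Suc (Suc (Suc j)))" "13/12 + M + 1 = 13/12 + of_nat (Suc (Suc (Suc j)))"
    "13/12 - M + 1 = 13/12 - of_nat (Suc j)" "13/12 + M - 1 = 13/12 + of_nat (Suc j)"
    by (simp_all add: M_def)
  ultimately show ?thesis unfolding Y_tilde_fps_def by (simp only: M_def)
qed

section \<open>Initial values and induction\<close>

lemma atkin_1_fps: "C_coeff_fps * U_tilde_fps 0 + D_coeff_fps * Y_tilde_fps 0 = fps_X - fps_const (5/12)"
proof -
  have "U_tilde_fps 0 = hyp2F1_fps (- 7/12) (17/12) (1/3)" "Y_tilde_fps 0 = hyp2F1_fps (1/12) (25/12) (5/3)"
    by (simp_all add: U_tilde_fps_def Y_tilde_fps_def U_scale_def Y_scale_def)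
  hence "12 * (C_coeff_fps * U_tilde_fps 0 + D_coeff_fps * Y_tilde_fps 0) = 12 * (fps_X - fps_const (5/12))"
    using C_D_coeff_fps_combination_1 by (simp add: right_diff_distrib numeral_fps_const)
  thus ?thesis by (subst (asm) mult_left_cancel) simp_all
qed

text \<open>The coefficient of the recurrence at index 1 has a vanishing denominator. The recurrence of
  the unscaled hypergeometric functions still holds there, and brings in $f$ and $g$ with weights
  for which the Wronskian identity applies.\<close>

lemma atkin_2_fps:
  "C_coeff_fps * U_tilde_fps 1 + D_coeff_fps * Y_tilde_fps 1 =
     (fps_X - fps_const (115/216)) * (fps_X - fps_const (5/12)) - fps_const (455/3456)"
proof -
  define f g u y where "f = hyp2F1_fps (5/12) (5/12) (1/3)" and "g = hyp2F1_fps (13/12) (13/12) (5/3)"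
    and "u = hyp2F1_fps (- 7/12) (17/12) (1/3)" and "y = hyp2F1_fps (1/12) (25/12) (5/3)"
  have uy: "U_tilde_fps 0 = u" "Y_tilde_fps 0 = y"
    by (simp_all add: U_tilde_fps_def Y_tilde_fps_def U_scale_def Y_scale_def u_def y_def)
  have "pochhammer (2 :: complex) 2 = 6" by (simp add: pochhammer_Suc numeral_2_eq_2)
  hence U1: "U_tilde_fps 1 = fps_const (- (187/864)) * hyp2F1_fps (- 19/12) (29/12) (1/3)"
    and Y1: "Y_tilde_fps 1 = fps_const (- (475/864)) * hyp2F1_fps (- 11/12) (37/12) (5/3)"
    by (simp_all add: U_tilde_fps_def Y_tilde_fps_def U_scale_def Y_scale_def)
  \<comment> \<open>The contiguous relation at M = 1 has exactly the scale -187/864 as leading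
    coefficient and 115/216 as diagonal coefficient; its lower neighbour, at M = 0, is
    \<open>f\<close>.\<close>
  have U: "U_tilde_fps 1 = (fps_X - fps_const (115/216)) * u + fps_const (91/288) * f"
    unfolding U1 using hyp2F1_fps_contiguous[OF not_nonpos_Int_thirds(1), of 1 "5/12"]
    by (simp add: u_def f_def fps_const_neg [symmetric] del: fps_const_neg)
  have Y: "Y_tilde_fps 1 = (fps_X - fps_const (115/216)) * y - fps_const (5/288) * g"
    unfolding Y1 using hyp2F1_fps_contiguous[OF not_nonpos_Int_thirds(4), of 1 "13/12"]
    by (simp add: y_def g_def)
  have "12 * (91 * (C_coeff_fps * f) - 5 * (D_coeff_fps * g)) = - 455"
    using C_D_coeff_fps_combination_0 unfolding f_def g_def .
  \<comment> \<open>Since 3456 = 12 * 288, this produces the weights 91/288 and -5/288 of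
    \<open>f\<close> and \<open>g\<close>.\<close>
  hence "fps_const (1/3456) * (12 * (91 * (C_coeff_fps * f) - 5 * (D_coeff_fps * g))) =
           fps_const (1/3456) * (- 455)" by (simp only:)
  hence eq: "fps_const (91/288) * (C_coeff_fps * f) - fps_const (5/288) * (D_coeff_fps * g) = - fps_const (455/3456)"
    by (simp add: right_diff_distrib numeral_fps_const flip: mult.assoc)
  have "C_coeff_fps * U_tilde_fps 1 + D_coeff_fps * Y_tilde_fps 1 =
          (fps_X - fps_const (115/216)) * (C_coeff_fps * u + D_coeff_fps * y) +
          (fps_const (91/288) * (C_coeff_fps * f) - fps_const (5/288) * (D_coeff_fps * g))"
    unfolding U Y by (simp only: algebra_simps)
  thus ?thesis using atkin_1_fps unfolding eq uy by simp
qed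

lemma fps_of_poly_linear: "fps_of_poly [:- b, 1:] = fps_X - fps_const (b :: complex)"
  by (simp add: fps_of_poly_pCons)

lemma fps_of_poly_atkin:
  "fps_of_poly (atkin (Suc n)) = C_coeff_fps * U_tilde_fps n + D_coeff_fps * Y_tilde_fps n"
proof (induction n rule: induct_nat_012)
  case 0
  show ?case using fps_of_poly_linear[of "5/12"] by (simp add: atkin_1_fps)
next
  case 1
  \<comment> \<open>The second polynomial in the shape of a recurrence at index 1, with 455/3456 in
    place of the undefined coefficient.\<close>
  have "atkin (Suc (Suc 0)) = [:- (115/216), 1:] * [:- (5/12), 1:] - [:455/3456:]"
    by simp
  thus ?case
    by (simp only: fps_of_poly_mult fps_of_poly_diff fps_of_poly_linear fps_of_poly_const
          atkin_2_fps [unfolded One_nat_def])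
next
  case (ge2 j)
  \<comment> \<open>The recurrence at index M produces the polynomial of degree M + 1, here j + 3,
    which matches the U and Y series at index j + 2.\<close>
  define M :: complex where "M = of_nat (Suc (Suc j))"
  have "atkin (Suc (Suc (Suc j))) = [:- atkin_b M, 1:] * atkin (Suc (Suc j)) - smult (atkin_c M) (atkin (Suc j))"
    by (simp only: atkin.simps Let_def atkin_b_def atkin_c_def M_def)
  hence "fps_of_poly (atkin (Suc (Suc (Suc j)))) =
           (fps_X - fps_const (atkin_b M)) * fps_of_poly (atkin (Suc (Suc j))) -
           fps_const (atkin_c M) * fps_of_poly (atkin (Suc j))"
    by (simp only: fps_of_poly_mult fps_of_poly_diff fps_of_poly_linear fps_of_poly_smult)
  also have "\<dots> = C_coeff_fps * U_tilde_fps (Suc (Suc j)) + D_coeff_fps * Y_tilde_fps (Suc (Suc j))"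
    unfolding ge2.IH U_tilde_fps_rec Y_tilde_fps_rec M_def by (simp only: algebra_simps)
  finally show ?case .
qed

section \<open>From power series to functions on the slit plane\<close>

lemma
  assumes "b \<in> \<real>" "c \<in> \<real>" "c \<notin> \<int>\<^sub>\<le>\<^sub>0"
  shows holomorphic_hyp2F1_real [holomorphic_intros]: "hyp2F1 a b c holomorphic_on cut_plane"
    and hyp2F1_real_has_fps_expansion [fps_expansion_intros]:
          "hyp2F1 a b c has_fps_expansion hyp2F1_fps a b c"
proof -
  obtain b' c' where bc: "b = of_real b'" "c = of_real c'"
    using assms by (auto elim!: Reals_cases)
  have "continuable (hyp2F1_fps a b c)"
    using assms(3) unfolding bc by (intro continuable_hyp2F1_fps) (simp add: of_real_in_nonpos_Ints_iff)
  thus "hyp2F1 a b c holomorphic_on cut_plane" "hyp2F1 a b c has_fps_expansion hyp2F1_fps a b c"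
    by (rule holomorphic_hyp2F1 hyp2F1_has_fps_expansion)+
qed

text \<open>The symbol (c + 1)_n = (19/12)_n cancels between the prefactor of the tilde function and
  U; the other three have bases 11/12, 17/12 and 2.\<close>

lemma U_tilde_eq:
  "U_tilde (1/2) (- 2/3) n x (7/12) =
     U_scale n * hyp2F1 (5/12 - of_nat (Suc n)) (5/12 + of_nat (Suc n)) (1/3) x"
proof -
  have "- of_nat n - 7/12 = (5/12 - of_nat (Suc n) :: complex)"
    "of_nat n + 1/2 + (- 2/3) + 7/12 + 1 = (5/12 + of_nat (Suc n) :: complex)"
    "1 + (- 2/3) = (1/3 :: complex)" by simp_all
  moreover have "pochhammer (19/12 :: complex) n \<noteq> 0"
    using pochhammer_pos[of "19/12 :: real" n] pochhammer_of_real[of "19/12" n, where 'a = complex] by simp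
  ultimately show ?thesis
    unfolding U_tilde_def U_def U_scale_def by (simp del: of_nat_Suc)
qed

text \<open>Here the cancelling symbol is (17/12)_n, which leaves the bases 19/12, 25/12 and
  2.\<close>

lemma Y_tilde_eq:
  "Y_tilde (1/2) (- 2/3) n x (7/12) =
     Y_scale n * hyp2F1 (13/12 - of_nat (Suc n)) (13/12 + of_nat (Suc n)) (5/3) x"
proof -
  have "- of_nat n - (- 2/3) - 7/12 = (13/12 - of_nat (Suc n) :: complex)"
    "of_nat n + 1/2 + 7/12 + 1 = (13/12 + of_nat (Suc n) :: complex)"
    "1 - (- 2/3) = (5/3 :: complex)" by simp_all
  moreover have "pochhammer (17/12 :: complex) n \<noteq> 0"
    using pochhammer_pos[of "17/12 :: real" n] pochhammer_of_real[of "17/12" n, where 'a = complex] by simp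
  ultimately show ?thesis
    unfolding Y_tilde_def Y_def Y_scale_def by (simp del: of_nat_Suc)
qed

lemma fps_of_poly_has_fps_expansion: "poly p has_fps_expansion fps_of_poly p" for p :: "complex poly"
  unfolding has_fps_expansion_def by (simp add: eval_fps_of_poly)

theorem theorem5p1:
  fixes n :: nat and x :: complex
  assumes "x \<in> UNIV - complex_of_real ` {1..}"
  shows "poly (atkin (n + 1)) x =
           C_coeff x * U_tilde (1/2) (- 2/3) n x (7/12)
         + D_coeff x * Y_tilde (1/2) (- 2/3) n x (7/12)"
proof -
  define R where "R = (\<lambda>x. C_coeff x * U_tilde (1/2) (- 2/3) n x (7/12)
                         + D_coeff x * Y_tilde (1/2) (- 2/3) n x (7/12))"
  note [simp] = not_nonpos_Int_thirds
  have R_holo: "R holomorphic_on cut_plane"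
    unfolding R_def U_tilde_eq Y_tilde_eq C_coeff_def D_coeff_def
    by (intro holomorphic_intros) (simp_all del: of_nat_Suc)
  have "R has_fps_expansion C_coeff_fps * U_tilde_fps n + D_coeff_fps * Y_tilde_fps n"
    unfolding R_def U_tilde_eq Y_tilde_eq C_coeff_def D_coeff_def
      C_coeff_fps_def D_coeff_fps_def U_tilde_fps_def Y_tilde_fps_def
    by (intro fps_expansion_intros) (simp_all del: of_nat_Suc)
  hence "R has_fps_expansion fps_of_poly (atkin (n + 1))"
    using fps_of_poly_atkin[of n] by simp
  hence "(\<lambda>x. poly (atkin (n + 1)) x - R x) has_fps_expansion
           fps_of_poly (atkin (n + 1)) - fps_of_poly (atkin (n + 1))"
    by (intro has_fps_expansion_diff fps_of_poly_has_fps_expansion)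
  hence "(\<lambda>x. poly (atkin (n + 1)) x - R x) has_fps_expansion 0"
    by simp
  moreover have "(\<lambda>x. poly (atkin (n + 1)) x - R x) holomorphic_on cut_plane"
    by (intro holomorphic_intros R_holo)
  moreover have "x \<in> cut_plane"
    using assms by (simp add: cut_plane_def)
  \<comment> \<open>Identity theorem: a holomorphic function on the connected slit plane with zero
    Taylor series at 0 vanishes at x.\<close>
  ultimately have "poly (atkin (n + 1)) x - R x = 0"
    using open_cut_plane connected_cut_plane zero_in_cut_plane
    by (intro has_fps_expansion_0_analytic_continuation[where x = x and A = cut_plane])
  thus ?thesis by (simp add: R_def)
qed

end
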